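(* Let $\delta, \gamma \in (0,1)$ be fixed. Let $C(N)$ be a real-valued function of the positive integer $N$ satisfying $2/\delta \leqslant C(N) \leqslant (\log N)^{\gamma}$ for all sufficiently large $N$, and put $T = T(N) = N^{C(N)}$. Then there exists $N_0$ (not depending on $f$) such that for all integers $N \geqslant N_0$ and all completely multiplicative functions $f:\mathbb{N}\to\mathbb{C}$ with $|f(n)|=1$ for all $n\in\mathbb{N}$, \[ \sup_{t\in\mathbb{R},\ |t|\leqslant T} |D_{f,N}(t)| \geqslant \exp\left(\sqrt{(1-\delta)\frac{\log T}{\log\log T}}\right), \] where $D_{f,N}(t) = \frac{1}{\sqrt{N}}\sum_{n\leqslant N} f(n) n^{it}$.
   Context: $\mathbb{N}$ denotes the positive integers. A function $f:\mathbb{N}\to\mathbb{C}$ is completely multiplicative if $f(1)=1$ and $f(mn)=f(m)f(n)$ for all $m,n\in\mathbb{N}$. For such $f$, a positive integer $N$ and real $t$, the Dirichlet polynomial is $D_{f,N}(t) = \frac{1}{\sqrt{N}}\sum_{n\leqslant N} f(n) n^{it}$, where the sum is over positive integers $n\leqslant N$ and $n^{it} = e^{it\log n}$. $\log$ denotes the natural logarithm. *)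

theory Defs
  imports "HOL-Analysis.Analysis"
begin

text \<open>Arithmetic functions live on the positive integers; they are represented by functions on
  \<^typ>\<open>nat\<close> whose value at 0 is irrelevant.\<close>

definition completely_multiplicative :: "(nat \<Rightarrow> complex) \<Rightarrow> bool" where
  "completely_multiplicative f \<longleftrightarrow>
     f 1 = 1 \<and> (\<forall>m\<ge>1. \<forall>n\<ge>1. f (m * n) = f m * f n)"

definition dirichlet_poly :: "(nat \<Rightarrow> complex) \<Rightarrow> nat \<Rightarrow> real \<Rightarrow> complex" where
  "dirichlet_poly f N t =
     (1 / of_real (sqrt (real N))) * (\<Sum>n=1..N. f n * of_nat n powr (\<i> * of_real t))"

end

theory Submission
  imports Defs "HOL-Number_Theory.Prime_Powers" "HOL-Real_Asymp.Real_Asymp"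
begin

text \<open>
  The resonance method. Put \<open>X = ln T\<close>. Two Dirichlet polynomials \<open>R\<close> and \<open>S\<close>, twisted by the values
  of \<open>f\<close>, are chosen so that the diagonal of the mean value of \<open>D R (cnj S)\<close> over \<open>[-T, T]\<close> has
  non-negative terms free of \<open>f\<close>. The off-diagonal terms are negligible as long as all frequencies stay
  below about \<open>T / sqrt N\<close>. The coefficients of \<open>R\<close> are supported on products of distinct primes
  \<open>p\<close> between \<open>X\<close> and \<open>X powr A\<close> and multiplicative, with \<open>r p = L / (sqrt p * ln p)\<close> as in
  Soundararajan's work; those of \<open>S\<close> are the same with an additional prime factor \<open>k\<close> of weight
  \<open>1 / sqrt k\<close>, which brings the summation variable \<open>n = k b\<close> close to \<open>N\<close> at the cost of powers of
  \<open>ln N\<close> only. The length restrictions on the coefficients are removed by Markov's inequality, and the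
  value of the resulting Euler product comes from Mertens' first theorem.
\<close>

text \<open>\<open>dirichlet_poly\<close> weights every n by 1 / sqrt N instead of 1 / sqrt n. Let b
  be the product of the primes that occur in the \<open>S\<close>-coefficient but not in the
  \<open>R\<close>-coefficient. Without k the diagonal would have n = b, mostly far below N, and
  lose a factor sqrt (N / b) against the weight 1 / sqrt b that produces the Euler product. Summing
  1 / sqrt k over primes k up to N / b restores this factor up to a logarithm. Since only one side
  carries k, the usual square of one resonator becomes \<open>R (cnj S)\<close>. The gain is about
  exp (L * sum of 1 / (p ln p)), roughly exp (L / ln X). The length restriction forces L ^ 2 to be
  about X ln X, whence exp (sqrt (X / ln X)). Both bounds on \<open>C\<close> matter. The lower one
  gives ln N <= (\<delta> / 2) X, so a loss of less than two powers of N in the resonator length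
  costs less than \<delta> in the exponent. The upper one gives ln N >= X powr (1 / (1 + \<gamma>)),
  with exponent above 1/2. As ln b has mean about sqrt X up to logarithms, the requirement b <= sqrt
  N is then almost free.\<close>

section \<open>Mertens' first theorem\<close>

lemma odd_central_binomial_le: "(2 * m + 1) choose m \<le> 4 ^ m"
proof -
  have "(2 * m + 1) choose m = (2 * m + 1) choose (m + 1)"
    by (subst binomial_symmetric) auto
  hence "2 * ((2 * m + 1) choose m) = (\<Sum>k\<in>{m, m + 1}. (2 * m + 1) choose k)"
    by simp
  also have "\<dots> \<le> (\<Sum>k\<le>2 * m + 1. (2 * m + 1) choose k)"
    by (rule sum_mono2) auto
  also have "\<dots> = 2 * 4 ^ m"
    by (simp only: choose_row_sum) (simp add: power_mult)
  finally show ?thesis by simp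
qed

lemma prod_primes_dvd:
  fixes n :: nat
  assumes "finite A" "\<And>p. p \<in> A \<Longrightarrow> prime p" "\<And>p. p \<in> A \<Longrightarrow> p dvd n"
  shows "\<Prod>A dvd n"
  using assms
proof (induction A rule: finite_induct)
  case (insert p A)
  have "coprime p (\<Prod>A)"
    using insert.hyps insert.prems(1) by (intro prod_coprime_right primes_coprime) auto
  with insert show ?case by (simp add: divides_mult)
qed auto

text \<open>Erdos's induction. An even n > 2 adds no prime. For n = 2 m + 1 the primes in (m + 1, n]
  all divide \<open>n choose m\<close>, because they divide \<open>fact n\<close> but neither
  \<open>fact m\<close> nor \<open>fact (m + 1)\<close>. So their product is at most 4 ^ m, and the
  remaining primes are covered by the induction hypothesis for m + 1.\<close>

lemma prod_primes_le: "(\<Prod>p | prime p \<and> p \<le> n. p) \<le> (4 :: nat) ^ n"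
proof (induction n rule: less_induct)
  case (less n)
  consider "n \<le> 1" | "n = 2" | "n > 2" "even n" | "n > 2" "odd n" by linarith
  thus ?case
  proof cases
    case 1
    hence "{p. prime p \<and> p \<le> n} = {}" by (auto dest: prime_ge_2_nat)
    thus ?thesis by (metis (no_types, lifting) one_le_numeral one_le_power prod.empty)
  next
    case 2
    hence "{p. prime p \<and> p \<le> n} = {2}" by (auto dest: prime_ge_2_nat)
    thus ?thesis using 2 by simp
  next
    case 3
    have "\<not> prime n" using 3 prime_odd_nat by blast
    hence "{p. prime p \<and> p \<le> n} = {p. prime p \<and> p \<le> n - 1}"
    proof (intro Collect_cong conj_cong refl)
      fix p :: nat assume "prime p"
      with \<open>\<not> prime n\<close> have "p \<noteq> n" by auto
      thus "p \<le> n \<longleftrightarrow> p \<le> n - 1" by linarith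
    qed
    hence "(\<Prod>p | prime p \<and> p \<le> n. p) \<le> 4 ^ (n - 1)"
      using less.IH[of "n - 1"] 3 by simp
    also have "\<dots> \<le> 4 ^ n" by (rule power_increasing) auto
    finally show ?thesis .
  next
    case 4
    then obtain m where n: "n = 2 * m + 1" using oddE by blast
    have m: "m \<ge> 1" using n 4 by auto
    let ?A = "{p. prime p \<and> p \<le> m + 1}" and ?B = "{p. prime p \<and> m + 1 < p \<and> p \<le> n}"
    have eq: "{p. prime p \<and> p \<le> n} = ?A \<union> ?B" using n m by auto
    have "(\<Prod>p\<in>?B. p) dvd n choose m"
    proof (rule prod_primes_dvd)
      show "p dvd n choose m" if "p \<in> ?B" for p
      proof -
        have "p dvd fact n" using that by (simp add: prime_dvd_fact_iff)
        also have "fact n = fact m * fact (m + 1) * (n choose m)"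
          using binomial_fact_lemma[of m n] n by (simp only:) simp
        finally show ?thesis using that
          by (simp only: prime_dvd_mult_iff prime_dvd_fact_iff mem_Collect_eq) simp
      qed
    qed auto
    hence "(\<Prod>p\<in>?B. p) \<le> n choose m" using n by (intro dvd_imp_le) auto
    also have "\<dots> \<le> 4 ^ m" unfolding n by (rule odd_central_binomial_le)
    finally have B: "(\<Prod>p\<in>?B. p) \<le> 4 ^ m" .
    have "(\<Prod>p | prime p \<and> p \<le> n. p) = (\<Prod>p\<in>?A. p) * (\<Prod>p\<in>?B. p)"
      unfolding eq by (rule prod.union_disjoint) auto
    also have "\<dots> \<le> 4 ^ (m + 1) * 4 ^ m"
      using less.IH[of "m + 1"] n m B by (intro mult_mono) auto
    also have "\<dots> = 4 ^ n" by (simp add: n power_add mult_2)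
    finally show ?thesis .
  qed
qed

lemma sum_ln_primes_le:
  fixes n :: nat
  shows "(\<Sum>p | prime p \<and> p \<le> n. ln (real p)) \<le> n * ln 4"
proof -
  have fin: "finite {p::nat. prime p \<and> p \<le> n}" by (rule finite_subset[of _ "{..n}"]) auto
  have "(\<Sum>p | prime p \<and> p \<le> n. ln (real p)) = ln (\<Prod>p | prime p \<and> p \<le> n. real p)"
    using fin by (subst ln_prod) (auto dest: prime_gt_0_nat)
  also have "(\<Prod>p | prime p \<and> p \<le> n. real p) = real (\<Prod>p | prime p \<and> p \<le> n. p)" by simp
  also have "ln \<dots> \<le> ln (real (4 ^ n))"
    using prod_primes_le[of n] fin
    by (subst ln_le_cancel_iff) (auto simp del: of_nat_prod of_nat_power simp: prod_pos prime_gt_0_nat)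
  also have "\<dots> = n * ln 4" by (simp add: ln_realpow)
  finally show ?thesis .
qed

section \<open>Mertens' first theorem from the factorisation of n!\<close>

lemma ln_fact_le: "ln (fact n) \<le> n * ln (real n)"
proof -
  have "real (fact n) \<le> real (n ^ n)" using fact_le_power[of n, where ?'a = nat] by (simp only: of_nat_le_iff of_nat_id)
  moreover have "(0::real) < fact n" by simp
  ultimately have "ln (fact n :: real) \<le> ln (real n ^ n)"
    by (subst ln_le_cancel_iff) (simp_all, linarith)
  thus ?thesis by (cases "n = 0") (auto simp: ln_realpow)
qed

lemma ln_fact_ge: "ln (fact n) \<ge> n * ln (real n) - n"
proof (induction n)
  case (Suc n)
  show ?case
  proof (cases "n = 0")
    case False
    have "real (Suc n) = real n * (1 + 1 / n)" using False by (simp add: field_simps)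
    also have "ln \<dots> = ln (real n) + ln (1 + 1 / n)"
      using False by (intro ln_mult_pos) (auto intro: add_pos_nonneg)
    finally have "real n * ln (real (Suc n)) = real n * ln (real n) + real n * ln (1 + 1 / n)"
      by (simp only: distrib_left)
    also have "real n * ln (1 + 1 / n) \<le> real n * (1 / n)"
      by (intro mult_left_mono ln_add_one_self_le_self) auto
    finally have "real n * ln (real (Suc n)) \<le> real n * ln (real n) + 1" using False by simp
    moreover have "ln (fact (Suc n) :: real) = ln (fact n) + ln (real (Suc n))"
      by (subst fact_Suc, subst ln_mult) (auto simp del: of_nat_Suc)
    ultimately show ?thesis using Suc by (simp add: algebra_simps)
  qed auto
qed auto

text \<open>Legendre's formula: each ln m is the sum of \<open>mangoldt\<close> over the divisors of
  m, and after exchanging the sums d is counted once for each of its \<open>n div d\<close>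
  multiples.\<close>

lemma ln_fact_mangoldt: "ln (fact n) = (\<Sum>d=1..n. mangoldt d * real (n div d))"
proof -
  have "ln (fact n :: real) = (\<Sum>m=1..n. ln (real m))"
    by (simp only: fact_prod of_nat_prod) (subst ln_prod, auto)
  also have "\<dots> = (\<Sum>m=1..n. \<Sum>d | d \<in> {1..n} \<and> d dvd m. mangoldt d)"
  proof (rule sum.cong[OF refl])
    fix m assume m: "m \<in> {1..n}"
    have "{d. d \<in> {1..n} \<and> d dvd m} = {d. d dvd m}"
    proof (intro Collect_cong iffI conjI)
      fix d assume "d dvd m"
      thus "d \<in> {1..n}" using m dvd_imp_le[of d m] dvd_pos_nat[of m d] by simp
    qed auto
    thus "ln (real m) = (\<Sum>d | d \<in> {1..n} \<and> d dvd m. mangoldt d)"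
      using mangoldt_sum[of m, where ?'a = real] m by simp
  qed
  also have "\<dots> = (\<Sum>d=1..n. \<Sum>m | m \<in> {1..n} \<and> d dvd m. mangoldt d)"
    by (rule sum.swap_restrict) auto
  also have "\<dots> = (\<Sum>d=1..n. mangoldt d * real (n div d))"
  proof (rule sum.cong[OF refl])
    fix d assume d: "d \<in> {1..n}"
    have "{m. m \<in> {1..n} \<and> d dvd m} = (\<lambda>k. d * k) ` {1..n div d}"
      using d by (auto simp: less_eq_div_iff_mult_less_eq mult.commute elim!: dvdE)
    hence "card {m. m \<in> {1..n} \<and> d dvd m} = n div d"
      using d by (simp add: card_image inj_on_def)
    thus "(\<Sum>m | m \<in> {1..n} \<and> d dvd m. mangoldt d) = mangoldt d * real (n div d)" by simp
  qed
  finally show ?thesis .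
qed

text \<open>Only the powers p ^ k with k >= 2 contribute. Their geometric series is at most 2 / p ^
  2, and ln p <= 2 sqrt p then gives the convergent majorant \<open>g\<close>, summed over all
  integers.\<close>

lemma sum_mangoldt_nonprime_bounded:
  "\<exists>C. \<forall>n. (\<Sum>d | d \<in> {1..n} \<and> \<not> prime d. mangoldt d / real d) \<le> C"
proof -
  define g where "g = (\<lambda>p::nat. 4 * real p powr (- (3/2)))"
  have summ: "summable g" unfolding g_def
    by (intro summable_mult) (simp add: summable_real_powr_iff)
  have "(\<Sum>d | d \<in> {1..n} \<and> \<not> prime d. mangoldt d / real d) \<le> suminf g" for n
  proof -
    let ?h = "\<lambda>(p::nat, k::nat). p ^ k"
    let ?P = "{p. prime p \<and> p \<le> n}"
    let ?S = "?P \<times> {2..n}"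
    have fin: "finite ?P" by (rule finite_subset[of _ "{..n}"]) auto
    let ?D = "{d. d \<in> {1..n} \<and> \<not> prime d}"
    have sub: "{d \<in> ?D. primepow d} \<subseteq> ?h ` ?S"
    proof
      fix d assume d: "d \<in> {d \<in> ?D. primepow d}"
      then obtain p k where pk: "prime p" "k > 0" "d = p ^ k"
        by (auto simp: primepow_def)
      have "k \<noteq> 1" using d pk by auto
      moreover have "k \<le> n"
        using pk d less_exp[of k] power_mono[of 2 p k] prime_ge_2_nat[of p]
        by (simp, linarith)
      moreover have "p \<le> n"
        using pk d self_le_power[of p k] prime_ge_1_nat[of p] by simp
      ultimately show "d \<in> ?h ` ?S" using pk by (intro image_eqI[of _ _ "(p, k)"]) auto
    qed
    have "(\<Sum>d\<in>?D. mangoldt d / real d) = (\<Sum>d\<in>{d \<in> ?D. primepow d}. mangoldt d / real d)"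
      by (rule sum.mono_neutral_right) (auto simp: mangoldt_def)
    also have "\<dots> \<le> (\<Sum>d\<in>?h ` ?S. mangoldt d / real d)"
      using fin sub by (intro sum_mono2) (auto simp: mangoldt_nonneg)
    also have "\<dots> \<le> (\<Sum>x\<in>?S. mangoldt (?h x) / real (?h x))"
      using fin sum_image_le[of ?S "\<lambda>d. mangoldt d / real d" ?h]
      by (simp add: mangoldt_nonneg o_def)
    also have "\<dots> = (\<Sum>p\<in>?P. \<Sum>k\<in>{2..n}. ln (real p) / real p ^ k)"
      by (subst sum.cartesian_product) (auto intro!: sum.cong)
    also have "\<dots> \<le> (\<Sum>p\<in>?P. g p)"
    proof (rule sum_mono)
      fix p assume p: "p \<in> ?P"
      hence p2: "real p \<ge> 2" by (auto dest: prime_ge_2_nat)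
      have "(\<Sum>k\<in>{2..n}. (1 / real p) ^ k) \<le> 2 / real p ^ 2"
      proof (cases "n \<ge> 2")
        case True
        have "(1 - 1 / real p) * (\<Sum>k\<in>{2..n}. (1 / real p) ^ k) = (1 / real p) ^ 2 - (1 / real p) ^ Suc n"
          using sum_gp_multiplied[OF True, of "1 / real p"] by simp
        also have "\<dots> \<le> (1 / real p) ^ 2" by simp
        finally have *: "(1 - 1 / real p) * (\<Sum>k\<in>{2..n}. (1 / real p) ^ k) \<le> (1 / real p) ^ 2" .
        have "(1 / 2) * (\<Sum>k\<in>{2..n}. (1 / real p) ^ k) \<le>
              (1 - 1 / real p) * (\<Sum>k\<in>{2..n}. (1 / real p) ^ k)"
          using p2 by (intro mult_right_mono sum_nonneg) (auto simp: field_simps)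
        with * have "(\<Sum>k\<in>{2..n}. (1 / real p) ^ k) \<le> 2 * (1 / real p) ^ 2" by linarith
        thus ?thesis by (simp add: power_divide)
      qed auto
      hence "ln (real p) * (\<Sum>k\<in>{2..n}. (1 / real p) ^ k) \<le> ln (real p) * (2 / real p ^ 2)"
        using p2 by (intro mult_left_mono) auto
      also have "ln (real p) \<le> 2 * sqrt (real p)"
        using ln_sqrt[of "real p"] ln_less_self[of "sqrt (real p)"] p2 by (simp del: ln_less_self)
      hence "ln (real p) * (2 / real p ^ 2) \<le> 2 * sqrt (real p) * (2 / real p ^ 2)"
        by (intro mult_right_mono) auto
      also have "\<dots> = 4 * (real p powr (1/2) / real p powr 2)"
        using p2 by (simp add: powr_half_sqrt)
      also have "\<dots> = g p" using p2 by (simp only: powr_diff [symmetric]) (simp add: g_def)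
      finally show "(\<Sum>k\<in>{2..n}. ln (real p) / real p ^ k) \<le> g p"
        by (simp add: sum_distrib_left power_divide)
    qed
    also have "\<dots> \<le> suminf g"
      using fin summ by (intro sum_le_suminf) (auto simp: g_def)
    finally show ?thesis .
  qed
  thus ?thesis by blast
qed

text \<open>Compare ln (n!) with n times the prime sum through Legendre's formula. Replacing
  \<open>n div d\<close> by n / d only enlarges, and the prime powers cost O(n), which bounds the
  prime sum from below. Conversely each floor costs at most ln p, and Chebyshev's bound makes the
  total of these errors O(n).\<close>

lemma mertens_first_nat:
  "\<exists>C. \<forall>n\<ge>1. \<bar>(\<Sum>p | prime p \<and> p \<le> n. ln (real p) / real p) - ln (real n)\<bar> \<le> C"
proof -
  obtain C where C: "\<And>n. (\<Sum>d | d \<in> {1..n} \<and> \<not> prime d. mangoldt d / real d) \<le> C"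
    using sum_mangoldt_nonprime_bounded by blast
  have "\<bar>(\<Sum>p | prime p \<and> p \<le> n. ln (real p) / real p) - ln (real n)\<bar> \<le> \<bar>C\<bar> + ln 4 + 1" if n: "n \<ge> 1" for n
  proof -
    let ?P = "{p. prime p \<and> p \<le> n}" and ?D = "{d. d \<in> {1..n} \<and> \<not> prime d}"
    let ?S = "\<Sum>p\<in>?P. ln (real p) / real p"
    have fin: "finite ?P" by (rule finite_subset[of _ "{..n}"]) auto
    have eq: "{1..n} = ?P \<union> ?D" by (auto dest: prime_ge_1_nat)
    have "ln (fact n) \<le> (\<Sum>d=1..n. mangoldt d * (real n / real d))"
      unfolding ln_fact_mangoldt
      by (intro sum_mono mult_left_mono) (auto simp: mangoldt_nonneg of_nat_div_le_of_nat)
    also have "\<dots> = (\<Sum>d\<in>?P. mangoldt d * (real n / real d)) + (\<Sum>d\<in>?D. mangoldt d * (real n / real d))"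
      by (subst eq, rule sum.union_disjoint) (use fin in auto)
    also have "\<dots> = n * ?S + n * (\<Sum>d\<in>?D. mangoldt d / real d)"
      by (simp add: sum_distrib_left mult.commute)
    also have "\<dots> \<le> n * ?S + n * C"
      using C[of n] by (intro add_left_mono mult_left_mono) auto
    finally have "n * ln (real n) \<le> n * (?S + C + 1)"
      using ln_fact_ge[of n] by (simp add: algebra_simps)
    hence 1: "ln (real n) \<le> ?S + C + 1" using n by simp
    have "n * ?S = (\<Sum>p\<in>?P. ln (real p) * (real n / real p))" by (simp add: sum_distrib_left mult.commute)
    also have "\<dots> \<le> (\<Sum>p\<in>?P. ln (real p) * (real (n div p) + 1))"
    proof (intro sum_mono mult_left_mono)
      fix p assume "p \<in> ?P"
      hence p: "p > 0" by (auto dest: prime_gt_0_nat)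
      have "real n = real p * real (n div p) + real (n mod p)"
        by (metis of_nat_add of_nat_mult mult_div_mod_eq)
      moreover have "real (n mod p) \<le> real p" using p by simp
      ultimately show "real n / real p \<le> real (n div p) + 1" using p by (simp add: field_simps)
    qed (auto dest: prime_ge_1_nat)
    also have "\<dots> = (\<Sum>p\<in>?P. mangoldt p * real (n div p)) + (\<Sum>p\<in>?P. ln (real p))"
      by (simp add: ring_distribs sum.distrib)
    also have "(\<Sum>p\<in>?P. mangoldt p * real (n div p)) \<le> (\<Sum>p=1..n. mangoldt p * real (n div p))"
      by (rule sum_mono2) (auto simp: mangoldt_nonneg dest: prime_ge_1_nat)
    also have "\<dots> \<le> n * ln (real n)" using ln_fact_le[of n] by (simp add: ln_fact_mangoldt)
    also have "(\<Sum>p\<in>?P. ln (real p)) \<le> n * ln 4" by (rule sum_ln_primes_le)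
    finally have "n * ?S \<le> n * (ln (real n) + ln 4)" by (simp add: algebra_simps)
    hence 2: "?S \<le> ln (real n) + ln 4" using n by simp
    have "ln (4 :: real) \<ge> 0" by simp
    with 1 2 show ?thesis by linarith
  qed
  thus ?thesis by blast
qed

lemma finite_nat_real_le: "finite {p::nat. P p \<and> real p \<le> x}"
  by (rule finite_subset[of _ "{..nat \<lfloor>x\<rfloor>}"]) (auto simp: le_nat_floor)

lemma mertens_first:
  "\<exists>C>0. \<forall>x\<ge>1. \<bar>(\<Sum>p::nat | prime p \<and> real p \<le> x. ln (real p) / real p) - ln x\<bar> \<le> C"
proof -
  obtain C where C: "\<And>n. n \<ge> 1 \<Longrightarrow>
      \<bar>(\<Sum>p | prime p \<and> p \<le> n. ln (real p) / real p) - ln (real n)\<bar> \<le> C"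
    using mertens_first_nat by blast
  have "\<bar>(\<Sum>p::nat | prime p \<and> real p \<le> x. ln (real p) / real p) - ln x\<bar> \<le> \<bar>C\<bar> + 1" if x: "x \<ge> 1" for x
  proof -
    define n where "n = nat \<lfloor>x\<rfloor>"
    have n: "n \<ge> 1" "real n \<le> x" "x < real n + 1" using x unfolding n_def by linarith+
    have "ln x \<le> ln (real n * 2)" using n by (subst ln_le_cancel_iff) auto
    hence "ln x \<le> ln (real n) + 1" using n ln2_le_25_over_36 by (simp add: ln_mult)
    moreover have "ln (real n) \<le> ln x" using n by (subst ln_le_cancel_iff) auto
    moreover have "{p::nat. prime p \<and> real p \<le> x} = {p. prime p \<and> p \<le> n}"
      using n by (auto simp: n_def le_nat_floor)
    ultimately show ?thesis using C[OF n(1)] by simp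
  qed
  thus ?thesis by (intro exI[of _ "\<bar>C\<bar> + 1"]) auto
qed

section \<open>Prime sums over intervals\<close>

lemma mertens_first_interval:
  "\<exists>C>0. \<forall>x y. 1 \<le> x \<longrightarrow> x \<le> y \<longrightarrow>
     (\<Sum>p::nat | prime p \<and> x < real p \<and> real p \<le> y. ln (real p) / real p) \<ge> ln y - ln x - C"
proof -
  obtain C where C: "C > 0" "\<And>x. x \<ge> 1 \<Longrightarrow>
     \<bar>(\<Sum>p::nat | prime p \<and> real p \<le> x. ln (real p) / real p) - ln x\<bar> \<le> C"
    using mertens_first by blast
  have "(\<Sum>p::nat | prime p \<and> x < real p \<and> real p \<le> y. ln (real p) / real p) \<ge> ln y - ln x - 2 * C"
    if xy: "1 \<le> x" "x \<le> y" for x y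
  proof -
    have "{p::nat. prime p \<and> real p \<le> y} =
          {p. prime p \<and> real p \<le> x} \<union> {p. prime p \<and> x < real p \<and> real p \<le> y}"
      using xy by auto
    hence "(\<Sum>p::nat | prime p \<and> real p \<le> y. ln (real p) / real p) =
       (\<Sum>p::nat | prime p \<and> real p \<le> x. ln (real p) / real p) +
       (\<Sum>p::nat | prime p \<and> x < real p \<and> real p \<le> y. ln (real p) / real p)"
      using finite_nat_real_le[of "\<lambda>p. prime p \<and> x < real p" y]
      by (simp only:) (rule sum.union_disjoint, auto simp: finite_nat_real_le conj_assoc)
    thus ?thesis using C(2)[of x] C(2)[of y] xy by linarith
  qed
  thus ?thesis using C(1) by (intro exI[of _ "2 * C"]) auto
qed

text \<open>Partial summation in discrete form. Cut the range into blocks from y powr (a j) to y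
  powr (a (j + 1)) with equally spaced exponents. On a block 1 / (p ln p) is at least (ln p / p) /
  (a (j + 1) ln y) ^ 2, and Mertens gives the sum of ln p / p. What results is 1 / ln y times a
  Riemann sum of the integral of 1 / a ^ 2 from 1 to infinity, which is 1.\<close>

lemma sum_inverse_prime_ln:
  assumes "\<epsilon> > 0" "\<epsilon> < 1"
  shows "\<exists>A>1. \<forall>\<^sub>F y in at_top.
           (\<Sum>p::nat | prime p \<and> y < real p \<and> real p \<le> y powr A. 1 / (real p * ln (real p))) \<ge> (1 - \<epsilon>) / ln y"
proof -
  obtain C where C: "C > 0" "\<And>x y. 1 \<le> x \<Longrightarrow> x \<le> y \<Longrightarrow>
     (\<Sum>p::nat | prime p \<and> x < real p \<and> real p \<le> y. ln (real p) / real p) \<ge> ln y - ln x - C"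
    using mertens_first_interval by blast
  \<comment> \<open>Three losses of relative size \<eta> occur: one from Mertens' error term and two
    from the Riemann sum, at its left end and in its tail. With \<epsilon> / 4 they fit into
    \<epsilon>.\<close>
  define \<eta> where "\<eta> = \<epsilon> / 4"
  have \<eta>: "\<eta> > 0" "\<eta> < 1 / 4" using assms by (auto simp: \<eta>_def)
  \<comment> \<open>This many blocks make the tail 1 / a (J + 1) of the integral at most \<eta>. The
    number does not depend on y, so the exponent A = a J is a constant.\<close>
  obtain J :: nat where J: "real J > 1 / \<eta> ^ 2" using reals_Archimedean2 by blast
  have J0: "J > 0" using J \<eta> by (intro Nat.gr0I) (auto simp: field_simps)
  define a where "a = (\<lambda>j::nat. 1 + real j * \<eta>)"
  have a_pos: "a j \<ge> 1" for j using \<eta> by (simp add: a_def)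
  \<comment> \<open>The Riemann sum dominates a telescoping sum, since 1 / a - 1 / (a + \<eta>) <=
    \<eta> / a ^ 2.\<close>
  have tele: "(\<Sum>j<J. \<eta> / a (Suc j) ^ 2) \<ge> 1 - 2 * \<eta>"
  proof -
    have ge: "(\<Sum>j<J. 1 / a (Suc j) - 1 / a (Suc (Suc j))) \<le> (\<Sum>j<J. \<eta> / a (Suc j) ^ 2)"
    proof (rule sum_mono)
      fix j
      have eq: "a (Suc (Suc j)) = a (Suc j) + \<eta>" by (simp add: a_def algebra_simps)
      have "1 / a (Suc j) - 1 / a (Suc (Suc j)) = \<eta> / (a (Suc j) * a (Suc (Suc j)))"
        using a_pos[of "Suc j"] \<eta> unfolding eq by (simp add: field_simps)
      also have "\<dots> \<le> \<eta> / (a (Suc j) * a (Suc j))"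
        using a_pos[of "Suc j"] \<eta> unfolding eq by (intro divide_left_mono mult_left_mono mult_pos_pos) auto
      finally show "1 / a (Suc j) - 1 / a (Suc (Suc j)) \<le> \<eta> / a (Suc j) ^ 2"
        by (simp add: power2_eq_square)
    qed
    have "(\<Sum>j<J. 1 / a (Suc j) - 1 / a (Suc (Suc j))) = 1 / a 1 - 1 / a (Suc J)"
      by (induction J) simp_all
    moreover have "1 / a 1 \<ge> 1 - \<eta>" using \<eta> by (simp add: a_def field_simps)
    moreover have "1 / a (Suc J) \<le> \<eta>"
    proof -
      have "1 / \<eta> = (1 / \<eta> ^ 2) * \<eta>" using \<eta> by (simp add: power2_eq_square)
      also have "\<dots> \<le> real J * \<eta>" using J \<eta> by (intro mult_right_mono) auto
      also have "\<dots> \<le> a (Suc J)" using \<eta> by (simp add: a_def algebra_simps)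
      finally show ?thesis using \<eta> a_pos[of "Suc J"] by (simp add: field_simps)
    qed
    ultimately show ?thesis using ge by linarith
  qed
  \<comment> \<open>The error \<open>C\<close> of one block becomes at most \<eta> ^ 2 ln y, a
    fraction \<eta> of the block's main term \<eta> ln y.\<close>
  have "\<forall>\<^sub>F y::real in at_top. y > 1 \<and> ln y \<ge> C / \<eta> ^ 2"
    by (intro eventually_conj eventually_gt_at_top)
       (use ln_at_top in \<open>auto simp: filterlim_at_top\<close>)
  hence "\<forall>\<^sub>F y in at_top.
     (\<Sum>p::nat | prime p \<and> y < real p \<and> real p \<le> y powr a J. 1 / (real p * ln (real p))) \<ge> (1 - \<epsilon>) / ln y"
  proof eventually_elim
    case (elim y)
    hence y: "y > 1" "ln y > 0" and yC: "C \<le> \<eta> ^ 2 * ln y" using \<eta> by (auto simp: field_simps)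
    define x where "x = (\<lambda>j. y powr a j)"
    define B where "B = (\<lambda>j. {p::nat. prime p \<and> x j < real p \<and> real p \<le> x (Suc j)})"
    have x_ge: "x j > 1" for j using y a_pos[of j] by (auto simp: x_def intro!: gr_one_powr)
    have x_mono: "x i \<le> x j" if "i \<le> j" for i j
      using that y \<eta> by (auto simp: x_def a_def intro!: powr_mono mult_right_mono)
    have ln_x: "ln (x j) = a j * ln y" for j using y by (simp add: x_def ln_powr)
    have finB: "finite (B j)" for j
      using finite_nat_real_le[of "\<lambda>p. prime p \<and> x j < real p" "x (Suc j)"] by (simp add: B_def conj_assoc)
    have block: "(\<Sum>p\<in>B j. 1 / (real p * ln (real p))) \<ge> (1 - \<eta>) / ln y * (\<eta> / a (Suc j) ^ 2)" for j
    proof -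
      have "\<eta> * (1 - \<eta>) * ln y \<le> ln (x (Suc j)) - ln (x j) - C"
        using yC by (simp add: ln_x a_def algebra_simps power2_eq_square)
      also have "\<dots> \<le> (\<Sum>p\<in>B j. ln (real p) / real p)"
        unfolding B_def using x_ge[of j] x_mono[of j "Suc j"] by (intro C(2)) auto
      also have "\<dots> \<le> (\<Sum>p\<in>B j. ln (x (Suc j)) ^ 2 * (1 / (real p * ln (real p))))"
      proof (rule sum_mono)
        fix p assume p: "p \<in> B j"
        hence p1: "real p > 1" using x_ge[of j] by (auto simp: B_def)
        have "ln (real p) ^ 2 \<le> ln (x (Suc j)) ^ 2"
          using p p1 x_ge[of "Suc j"] by (intro power_mono) (auto simp: B_def)
        hence "ln (real p) ^ 2 * (1 / (real p * ln (real p))) \<le> ln (x (Suc j)) ^ 2 * (1 / (real p * ln (real p)))"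
          using p1 by (intro mult_right_mono) auto
        thus "ln (real p) / real p \<le> ln (x (Suc j)) ^ 2 * (1 / (real p * ln (real p)))"
          using p1 by (simp add: power2_eq_square)
      qed
      also have "\<dots> = a (Suc j) ^ 2 * ln y ^ 2 * (\<Sum>p\<in>B j. 1 / (real p * ln (real p)))"
        by (simp add: sum_distrib_left ln_x power_mult_distrib)
      finally have "\<eta> * (1 - \<eta>) * ln y / (a (Suc j) ^ 2 * ln y ^ 2) \<le> (\<Sum>p\<in>B j. 1 / (real p * ln (real p)))"
        using y a_pos[of "Suc j"] by (subst pos_divide_le_eq) (auto simp: mult_ac)
      thus ?thesis using y by (simp add: power2_eq_square mult_ac)
    qed
    have disj: "B i \<inter> B j = {}" if "i \<noteq> j" for i j
      using that
    proof (induction i j rule: linorder_wlog)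
      case (le i j)
      hence "x (Suc i) \<le> x j" by (intro x_mono) auto
      thus ?case by (auto simp: B_def)
    qed auto
    have "(1 - \<epsilon>) / ln y \<le> (1 - \<eta>) * (1 - 2 * \<eta>) / ln y"
    proof (rule divide_right_mono)
      have "(1 - \<eta>) * (1 - 2 * \<eta>) = 1 - 3 * \<eta> + 2 * \<eta> ^ 2" by (simp add: algebra_simps power2_eq_square)
      thus "1 - \<epsilon> \<le> (1 - \<eta>) * (1 - 2 * \<eta>)"
        using \<eta> zero_le_power2[of \<eta>] unfolding \<eta>_def by linarith
    qed (use y in auto)
    also have "\<dots> = (1 - \<eta>) / ln y * (1 - 2 * \<eta>)" by simp
    also have "\<dots> \<le> (1 - \<eta>) / ln y * (\<Sum>j<J. \<eta> / a (Suc j) ^ 2)"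
      using tele \<eta> y by (intro mult_left_mono) auto
    also have "\<dots> \<le> (\<Sum>j<J. \<Sum>p\<in>B j. 1 / (real p * ln (real p)))"
      unfolding sum_distrib_left by (intro sum_mono block)
    also have "\<dots> = (\<Sum>p\<in>(\<Union>j<J. B j). 1 / (real p * ln (real p)))"
      using finB disj by (intro sum.UNION_disjoint [symmetric]) auto
    also have "\<dots> \<le> (\<Sum>p::nat | prime p \<and> y < real p \<and> real p \<le> y powr a J. 1 / (real p * ln (real p)))"
    proof (rule sum_mono2)
      show "finite {p::nat. prime p \<and> y < real p \<and> real p \<le> y powr a J}"
        using finite_nat_real_le[of "\<lambda>p. prime p \<and> y < real p" "y powr a J"] by (simp add: conj_assoc)
      have "p \<in> {p. prime p \<and> y < real p \<and> real p \<le> y powr a J}" if "j < J" "p \<in> B j" for j p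
      proof -
        have "x 0 = y" using y by (simp add: x_def a_def)
        with that show ?thesis using x_mono[of 0 j] x_mono[of "Suc j" J] by (auto simp: B_def x_def)
      qed
      thus "(\<Union>j<J. B j) \<subseteq> {p. prime p \<and> y < real p \<and> real p \<le> y powr a J}" by blast
    qed (auto dest: prime_ge_1_nat)
    finally show ?case .
  qed
  moreover have "a J > 1" using J0 \<eta> by (simp add: a_def)
  ultimately show ?thesis by blast
qed

text \<open>With D = exp (C + 1), Mertens makes the sum of ln p / p over (x / D, x] at least 1. Each
  prime there satisfies ln p / p <= (ln x / sqrt (x / D)) * (1 / sqrt p). The explicit left end x /
  D is kept because these primes must later lie above all primes of the resonator.\<close>

lemma sum_inverse_sqrt_primes:
  "\<exists>D>1. \<forall>x\<ge>D. (\<Sum>p::nat | prime p \<and> x / D < real p \<and> real p \<le> x. 1 / sqrt (real p)) \<ge> sqrt (x / D) / ln x"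
proof -
  obtain C where C: "C > 0" "\<And>x y. 1 \<le> x \<Longrightarrow> x \<le> y \<Longrightarrow>
     (\<Sum>p::nat | prime p \<and> x < real p \<and> real p \<le> y. ln (real p) / real p) \<ge> ln y - ln x - C"
    using mertens_first_interval by blast
  define D where "D = exp (C + 1)"
  have D: "D > 1" using C by (simp add: D_def)
  have "(\<Sum>p::nat | prime p \<and> x / D < real p \<and> real p \<le> x. 1 / sqrt (real p)) \<ge> sqrt (x / D) / ln x"
    if x: "x \<ge> D" for x
  proof -
    let ?B = "{p::nat. prime p \<and> x / D < real p \<and> real p \<le> x}"
    have xD: "x / D \<ge> 1" "x / D \<le> x" using x D by (auto simp: field_simps)
    have "ln (x / D) = ln x - (C + 1)" using x D by (subst ln_div) (auto simp: D_def)
    hence "1 \<le> (\<Sum>p\<in>?B. ln (real p) / real p)"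
      using C(2)[OF xD] by simp
    also have "\<dots> \<le> (\<Sum>p\<in>?B. ln x / sqrt (x / D) * (1 / sqrt (real p)))"
    proof (rule sum_mono)
      fix p assume p: "p \<in> ?B"
      hence p1: "real p \<ge> 1" by (auto dest: prime_ge_1_nat)
      have "ln (real p) \<le> ln x" using p p1 by (subst ln_le_cancel_iff) auto
      moreover have "ln (real p) / real p = ln (real p) / sqrt (real p) * (1 / sqrt (real p))" using p1 by simp
      moreover have "ln (real p) / sqrt (real p) * (1 / sqrt (real p)) \<le> ln x / sqrt (x / D) * (1 / sqrt (real p))"
        using p p1 x D xD calculation by (intro mult_right_mono frac_le) auto
      ultimately show "ln (real p) / real p \<le> ln x / sqrt (x / D) * (1 / sqrt (real p))" by simp
    qed
    also have "\<dots> = ln x / sqrt (x / D) * (\<Sum>p\<in>?B. 1 / sqrt (real p))"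
      by (simp only: sum_distrib_left)
    finally show ?thesis using x D by (simp add: field_simps)
  qed
  thus ?thesis using D by blast
qed

section \<open>Mean values of Dirichlet polynomials\<close>

lemma harm_le_ln: "n > 0 \<Longrightarrow> harm n \<le> 1 + ln (real n)"
  using decseqD[OF decseq_harm_diff_ln, of 0 "n - 1"] by (simp add: harm_expand)

lemma sum_inverse_dist_le:
  assumes "u \<in> {1..q}"
  shows "(\<Sum>v\<in>{1..q} - {u}. 1 / \<bar>real u - real v\<bar>) \<le> 2 * (1 + ln (real q))"
proof -
  have q: "q > 0" using assms by auto
  have eq: "{1..q} - {u} = {1..<u} \<union> {u<..q}" using assms by auto
  have "(\<Sum>v\<in>{1..q} - {u}. 1 / \<bar>real u - real v\<bar>) =
     (\<Sum>v\<in>{1..<u}. 1 / \<bar>real u - real v\<bar>) + (\<Sum>v\<in>{u<..q}. 1 / \<bar>real u - real v\<bar>)"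
    unfolding eq by (rule sum.union_disjoint) auto
  also have "(\<Sum>v\<in>{1..<u}. 1 / \<bar>real u - real v\<bar>) = (\<Sum>k\<in>{1..<u}. 1 / real k)"
  proof (rule sum.reindex_bij_witness[of _ "\<lambda>k. u - k" "\<lambda>k. u - k"])
    fix v assume "v \<in> {1..<u}"
    thus "1 / real (u - v) = 1 / \<bar>real u - real v\<bar>" by (simp add: of_nat_diff)
  qed auto
  also have "\<dots> \<le> (\<Sum>k=1..q. 1 / real k)" using assms by (intro sum_mono2) auto
  also have "(\<Sum>v\<in>{u<..q}. 1 / \<bar>real u - real v\<bar>) = (\<Sum>k\<in>{1..q-u}. 1 / real k)"
  proof (rule sum.reindex_bij_witness[of _ "\<lambda>k. u + k" "\<lambda>k. k - u"])
    fix v assume "v \<in> {u<..q}"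
    thus "1 / real (v - u) = 1 / \<bar>real u - real v\<bar>" by (simp add: of_nat_diff)
  qed auto
  also have "\<dots> \<le> (\<Sum>k=1..q. 1 / real k)" using assms by (intro sum_mono2) auto
  also have "(\<Sum>k=1..q. 1 / real k) = harm q" by (simp add: harm_def inverse_eq_divide)
  also have "\<dots> \<le> 1 + ln (real q)" using q by (rule harm_le_ln)
  finally show ?thesis by simp
qed

lemma has_integral_cis:
  assumes "\<xi> \<noteq> 0" "0 \<le> T"
  shows "((\<lambda>t. cis (\<xi> * t)) has_integral (cis (\<xi> * T) - cis (- \<xi> * T)) / (\<i> * \<xi>)) {-T..T}"
proof -
  have [simp]: "\<i> * (x * (\<i> * y)) = - (x * y)" for x y
    proof -
    have "\<i> * (x * (\<i> * y)) = (\<i> * \<i>) * (x * y)" by (simp only: mult_ac)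
    thus ?thesis by simp
  qed
  have "((\<lambda>t. cis (\<xi> * t)) has_integral cis (\<xi> * T) / (\<i> * \<xi>) - cis (\<xi> * (- T)) / (\<i> * \<xi>)) {-T..T}"
    using assms
    by (intro fundamental_theorem_of_calculus)
       (auto simp: has_vector_derivative_def scaleR_conv_of_real fun_eq_iff intro!: derivative_eq_intros)
  thus ?thesis by (simp add: diff_divide_distrib)
qed

text \<open>The derivative of ln is at least 1 / q on (0, q]. This is the spacing of the frequencies
  ln n for n <= q.\<close>

lemma abs_ln_diff_ge:
  assumes "0 < x" "x \<le> q" "0 < y" "y \<le> (q::real)"
  shows "\<bar>ln x - ln y\<bar> \<ge> \<bar>x - y\<bar> / q"
  using assms
proof (induction x y rule: linorder_wlog)
  case (le x y)
  have "ln (x / y) \<le> x / y - 1" using le by (intro ln_le_minus_one) auto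
  hence "ln y - ln x \<ge> (y - x) / y" using le by (simp add: ln_div diff_divide_distrib)
  moreover have "(y - x) / y \<ge> (y - x) / q" using le by (intro divide_left_mono) auto
  ultimately show ?case using le by simp
qed (simp add: abs_minus_commute)

lemma powr_ii_mult_cnj:
  assumes "0 < x" "0 < y"
  shows "of_nat x powr (\<i> * of_real t) * cnj (of_nat y powr (\<i> * of_real t)) =
         cis ((ln (real x) - ln (real y)) * t)"
  using assms
  by (simp add: powr_def Ln_of_nat exp_cnj exp_add [symmetric] cis_conv_exp algebra_simps)

text \<open>Off the diagonal the primitive has modulus at most 1 / |\<xi>| for the frequency
  difference \<xi>, so the integral is bounded independently of T, whereas the diagonal grows like 2
  T.\<close>

lemma integral_powr_ii:
  assumes "x \<in> {1..q}" "y \<in> {1..q}" "T \<ge> 0"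
  shows "\<exists>I. ((\<lambda>t. of_nat x powr (\<i> * of_real t) * cnj (of_nat y powr (\<i> * of_real t))) has_integral I) {-T..T} \<and>
             (if x = y then I = 2 * T else norm I \<le> 2 * real q * (1 / \<bar>real x - real y\<bar>))"
proof (cases "x = y")
  case True
  have "((\<lambda>t. 1 :: complex) has_integral (complex_of_real (2 * T))) {-T..T}"
    using has_integral_const_real[of "1::complex" "-T" T] assms by (simp add: scaleR_conv_of_real)
  thus ?thesis using True assms by (intro exI[of _ "complex_of_real (2 * T)"]) (simp add: powr_ii_mult_cnj)
next
  case False
  define \<xi> where "\<xi> = ln (real x) - ln (real y)"
  have \<xi>: "\<bar>\<xi>\<bar> \<ge> \<bar>real x - real y\<bar> / q" unfolding \<xi>_def
    using assms by (intro abs_ln_diff_ge) auto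
  have pos: "\<bar>real x - real y\<bar> / q > 0" using False assms by simp
  define I where "I = (cis (\<xi> * T) - cis (- \<xi> * T)) / (\<i> * \<xi>)"
  have "norm I \<le> 2 / \<bar>\<xi>\<bar>" unfolding I_def norm_divide norm_mult
    using norm_triangle_ineq4[of "cis (\<xi> * T)" "cis (- \<xi> * T)"] by (simp add: divide_right_mono)
  also have "\<dots> \<le> 2 / (\<bar>real x - real y\<bar> / q)"
    using \<xi> pos by (intro divide_left_mono mult_pos_pos) auto
  finally have "norm I \<le> 2 * real q * (1 / \<bar>real x - real y\<bar>)" by simp
  moreover have "((\<lambda>t. cis (\<xi> * t)) has_integral I) {-T..T}"
    unfolding I_def using \<xi> pos assms by (intro has_integral_cis) auto
  hence "((\<lambda>t. of_nat x powr (\<i> * of_real t) * cnj (of_nat y powr (\<i> * of_real t))) has_integral I) {-T..T}"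
    using assms by (simp add: powr_ii_mult_cnj \<xi>_def)
  ultimately show ?thesis using False by auto
qed

text \<open>The row bound of Schur's test. Injectivity of \<open>v\<close> makes the values
  \<open>v j\<close> distinct integers, so a row is part of two harmonic sums around
  \<open>u i\<close>.\<close>

lemma sum_schur_le:
  fixes u :: "'i \<Rightarrow> nat" and v :: "'j \<Rightarrow> nat"
  assumes "finite I" "finite J" "inj_on v J" "u ` I \<subseteq> {1..q}" "v ` J \<subseteq> {1..q}" "\<And>i. i \<in> I \<Longrightarrow> c i \<ge> 0"
  shows "(\<Sum>i\<in>I. \<Sum>j\<in>J. if u i = v j then 0 else c i * (1 / \<bar>real (u i) - real (v j)\<bar>)) \<le>
         2 * (1 + ln (real q)) * (\<Sum>i\<in>I. c i)"
proof -
  have "(\<Sum>i\<in>I. \<Sum>j\<in>J. if u i = v j then 0 else c i * (1 / \<bar>real (u i) - real (v j)\<bar>)) \<le>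
        (\<Sum>i\<in>I. c i * (2 * (1 + ln (real q))))"
  proof (rule sum_mono)
    fix i assume i: "i \<in> I"
    have "(\<Sum>j\<in>J. if u i = v j then 0 else c i * (1 / \<bar>real (u i) - real (v j)\<bar>)) =
          c i * (\<Sum>j\<in>J. if u i = v j then 0 else 1 / \<bar>real (u i) - real (v j)\<bar>)"
      unfolding sum_distrib_left by (intro sum.cong) auto
    also have "(\<Sum>j\<in>J. if u i = v j then 0 else 1 / \<bar>real (u i) - real (v j)\<bar>) =
       (\<Sum>n\<in>v ` J. if u i = n then 0 else 1 / \<bar>real (u i) - real n\<bar>)"
      using assms by (subst sum.reindex) auto
    also have "\<dots> \<le> (\<Sum>n\<in>{1..q}. if u i = n then 0 else 1 / \<bar>real (u i) - real n\<bar>)"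
      using assms by (intro sum_mono2) auto
    also have "\<dots> = (\<Sum>n\<in>{1..q} - {u i}. 1 / \<bar>real (u i) - real n\<bar>)"
      by (intro sum.mono_neutral_cong_right) auto
    also have "\<dots> \<le> 2 * (1 + ln (real q))" using assms i by (intro sum_inverse_dist_le) auto
    finally show "(\<Sum>j\<in>J. if u i = v j then 0 else c i * (1 / \<bar>real (u i) - real (v j)\<bar>)) \<le>
        c i * (2 * (1 + ln (real q)))" using assms(6)[OF i] by (simp add: mult_left_mono)
  qed
  thus ?thesis by (simp add: sum_distrib_right [symmetric] sum_distrib_left mult.commute)
qed

text \<open>In the off-diagonal terms |a b| <= (|a| ^ 2 + |b| ^ 2) / 2 separates the coefficients.
  The first half is summed along rows and the second along columns by \<open>sum_schur_le\<close>.
  The logarithm lost against a Hilbert-type inequality fits into the room left between q and T. Two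
  index families are allowed because the polynomials n^(it) R and S have different
  frequencies.\<close>

lemma dirichlet_mean_value:
  fixes u :: "'i \<Rightarrow> nat" and v :: "'j \<Rightarrow> nat" and a :: "'i \<Rightarrow> complex" and b :: "'j \<Rightarrow> complex"
  assumes "finite I" "finite J" "inj_on u I" "inj_on v J" "u ` I \<subseteq> {1..q}" "v ` J \<subseteq> {1..q}" "T \<ge> 0"
  obtains K where
    "((\<lambda>t. (\<Sum>i\<in>I. a i * of_nat (u i) powr (\<i> * of_real t)) *
           cnj (\<Sum>j\<in>J. b j * of_nat (v j) powr (\<i> * of_real t))) has_integral K) {-T..T}"
    "norm (K - complex_of_real (2 * T) * (\<Sum>i\<in>I. \<Sum>j\<in>J. if u i = v j then a i * cnj (b j) else 0)) \<le>
       2 * real q * (1 + ln (real q)) * ((\<Sum>i\<in>I. norm (a i) ^ 2) + (\<Sum>j\<in>J. norm (b j) ^ 2))"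
proof -
  define e where "e = (\<lambda>n t. of_nat n powr (\<i> * complex_of_real t))"
  have "\<exists>k. ((\<lambda>t. e (u i) t * cnj (e (v j) t)) has_integral k) {-T..T} \<and>
     (if u i = v j then k = 2 * T else norm k \<le> 2 * real q * (1 / \<bar>real (u i) - real (v j)\<bar>))"
    if "i \<in> I" "j \<in> J" for i j
    unfolding e_def using that assms by (intro integral_powr_ii) auto
  then obtain k where k: "\<And>i j. i \<in> I \<Longrightarrow> j \<in> J \<Longrightarrow> ((\<lambda>t. e (u i) t * cnj (e (v j) t)) has_integral k i j) {-T..T}"
     "\<And>i j. i \<in> I \<Longrightarrow> j \<in> J \<Longrightarrow>
        if u i = v j then k i j = 2 * T else norm (k i j) \<le> 2 * real q * (1 / \<bar>real (u i) - real (v j)\<bar>)"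
    by metis
  define K where "K = (\<Sum>i\<in>I. \<Sum>j\<in>J. a i * cnj (b j) * k i j)"
  have int: "((\<lambda>t. \<Sum>i\<in>I. \<Sum>j\<in>J. a i * cnj (b j) * (e (u i) t * cnj (e (v j) t))) has_integral K) {-T..T}"
    unfolding K_def using assms k by (intro has_integral_sum has_integral_mult_right) auto
  have "K - complex_of_real (2 * T) * (\<Sum>i\<in>I. \<Sum>j\<in>J. if u i = v j then a i * cnj (b j) else 0) =
        (\<Sum>i\<in>I. \<Sum>j\<in>J. if u i = v j then 0 else a i * cnj (b j) * k i j)"
    unfolding K_def sum_distrib_left sum_subtractf [symmetric]
    using k(2) by (intro sum.cong refl) (auto split: if_splits)
  also have "norm \<dots> \<le> (\<Sum>i\<in>I. \<Sum>j\<in>J. real q * ((if u i = v j then 0 else norm (a i) ^ 2 * (1 / \<bar>real (u i) - real (v j)\<bar>)) +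
        (if v j = u i then 0 else norm (b j) ^ 2 * (1 / \<bar>real (v j) - real (u i)\<bar>))))"
  proof (intro order.trans[OF norm_sum] sum_mono)
    fix i j assume ij: "i \<in> I" "j \<in> J"
    show "norm (if u i = v j then 0 else a i * cnj (b j) * k i j) \<le>
       real q * ((if u i = v j then 0 else norm (a i) ^ 2 * (1 / \<bar>real (u i) - real (v j)\<bar>)) +
        (if v j = u i then 0 else norm (b j) ^ 2 * (1 / \<bar>real (v j) - real (u i)\<bar>)))"
    proof (cases "u i = v j")
      case False
      define d where "d = 1 / \<bar>real (u i) - real (v j)\<bar>"
      have "norm (a i * cnj (b j) * k i j) \<le> norm (a i) * norm (b j) * (2 * real q * d)"
        unfolding norm_mult complex_mod_cnj using k(2)[OF ij] False
        by (intro mult_left_mono) (auto simp: d_def)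
      also have "\<dots> = real q * d * (2 * norm (a i) * norm (b j))" by simp
      also have "\<dots> \<le> real q * d * (norm (a i) ^ 2 + norm (b j) ^ 2)"
        by (intro mult_left_mono sum_squares_bound) (auto simp: d_def)
      also have "\<dots> = real q * (norm (a i) ^ 2 * d + norm (b j) ^ 2 * d)" by (simp add: algebra_simps)
      finally show ?thesis using False by (simp add: d_def abs_minus_commute)
    qed auto
  qed
  also have "\<dots> = real q * ((\<Sum>i\<in>I. \<Sum>j\<in>J. if u i = v j then 0 else norm (a i) ^ 2 * (1 / \<bar>real (u i) - real (v j)\<bar>)) +
       (\<Sum>j\<in>J. \<Sum>i\<in>I. if v j = u i then 0 else norm (b j) ^ 2 * (1 / \<bar>real (v j) - real (u i)\<bar>)))"
    by (subst (2) sum.swap) (simp only: sum.distrib sum_distrib_left [symmetric])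
  also have "\<dots> \<le> real q * (2 * (1 + ln (real q)) * (\<Sum>i\<in>I. norm (a i) ^ 2) + 2 * (1 + ln (real q)) * (\<Sum>j\<in>J. norm (b j) ^ 2))"
    using assms by (intro mult_left_mono add_mono sum_schur_le) auto
  also have "\<dots> = 2 * real q * (1 + ln (real q)) * ((\<Sum>i\<in>I. norm (a i) ^ 2) + (\<Sum>j\<in>J. norm (b j) ^ 2))"
    by (simp add: algebra_simps)
  finally have "norm (K - complex_of_real (2 * T) * (\<Sum>i\<in>I. \<Sum>j\<in>J. if u i = v j then a i * cnj (b j) else 0)) \<le> \<dots>" .
  moreover have "(\<lambda>t. \<Sum>i\<in>I. \<Sum>j\<in>J. a i * cnj (b j) * (e (u i) t * cnj (e (v j) t))) =
     (\<lambda>t. (\<Sum>i\<in>I. a i * e (u i) t) * cnj (\<Sum>j\<in>J. b j * e (v j) t))"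
    by (simp add: sum_product cnj_sum mult_ac)
  ultimately show ?thesis using that int by (simp add: e_def)
qed

text \<open>The diagonal contributes 2 T times the square sum; the assumption on T lets the
  off-diagonal error contribute at most T times it. This is the origin of the factor 3. Twisting by
  \<open>f\<close> leaves all moduli unchanged.\<close>

lemma dirichlet_mean_square:
  fixes w :: "'i \<Rightarrow> nat" and c :: "'i \<Rightarrow> real" and f :: "nat \<Rightarrow> complex"
  assumes "finite A" "inj_on w A" "w ` A \<subseteq> {1..q}" "\<And>n. n \<ge> 1 \<Longrightarrow> norm (f n) = 1"
    and "(\<Sum>i\<in>A. c i ^ 2) \<le> W" and T: "2 * (2 * real q * (1 + ln (real q))) \<le> T" and "q \<ge> 1"
  shows "\<exists>K. ((\<lambda>t. norm (\<Sum>i\<in>A. (f (w i) * c i) * of_nat (w i) powr (\<i> * complex_of_real t)) ^ 2) has_integral K) {-T..T}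
            \<and> K \<le> 3 * T * W"
proof -
  define e where "e = (\<lambda>n t. of_nat n powr (\<i> * complex_of_real t))"
  define \<kappa> where "\<kappa> = 2 * real q * (1 + ln (real q))"
  have \<kappa>: "\<kappa> \<ge> 0" unfolding \<kappa>_def
    using \<open>q \<ge> 1\<close> by (intro mult_nonneg_nonneg add_nonneg_nonneg) auto
  have \<kappa>': "2 * \<kappa> \<le> T" using T by (simp only: \<kappa>_def)
  hence T0: "T \<ge> 0" using \<kappa> by linarith
  obtain K where K: "((\<lambda>t. (\<Sum>i\<in>A. (f (w i) * c i) * e (w i) t) * cnj (\<Sum>i\<in>A. (f (w i) * c i) * e (w i) t)) has_integral K) {-T..T}"
    "norm (K - complex_of_real (2 * T) * (\<Sum>i\<in>A. \<Sum>j\<in>A. if w i = w j then (f (w i) * c i) * cnj (f (w j) * c j) else 0)) \<le>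
     \<kappa> * ((\<Sum>i\<in>A. norm (f (w i) * c i) ^ 2) + (\<Sum>j\<in>A. norm (f (w j) * c j) ^ 2))"
    unfolding e_def \<kappa>_def
    by (rule dirichlet_mean_value[OF assms(1) assms(1) assms(2) assms(2) assms(3) assms(3) T0,
       where a = "\<lambda>i. f (w i) * c i" and b = "\<lambda>i. f (w i) * c i"])
  have nrm: "norm (f (w i) * c i) ^ 2 = c i ^ 2" if "i \<in> A" for i
    using assms(4)[of "w i"] that assms(3) by (auto simp: norm_mult)
  have "(\<Sum>i\<in>A. \<Sum>j\<in>A. if w i = w j then (f (w i) * c i) * cnj (f (w j) * c j) else 0) =
        (\<Sum>i\<in>A. \<Sum>j\<in>A. if i = j then (f (w i) * c i) * cnj (f (w i) * c i) else 0)"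
    using assms(2) by (intro sum.cong refl) (auto simp: inj_on_def)
  also have "\<dots> = (\<Sum>i\<in>A. (f (w i) * c i) * cnj (f (w i) * c i))"
    using assms(1) by (intro sum.cong refl) (simp only: sum.delta' if_True)
  also have "\<dots> = (\<Sum>i\<in>A. of_real (norm (f (w i) * c i) ^ 2))"
    by (intro sum.cong refl, rule complex_norm_square [symmetric])
  also have "\<dots> = complex_of_real (\<Sum>i\<in>A. c i ^ 2)" using nrm by (simp only: of_real_sum) simp
  finally have "norm (K - complex_of_real (2 * T) * complex_of_real (\<Sum>i\<in>A. c i ^ 2)) \<le> \<kappa> * ((\<Sum>i\<in>A. c i ^ 2) + (\<Sum>i\<in>A. c i ^ 2))"
    using K(2) nrm by (simp only: sum.cong[OF refl nrm])
  moreover have "Re (K - complex_of_real (2 * T) * complex_of_real (\<Sum>i\<in>A. c i ^ 2)) = Re K - 2 * T * (\<Sum>i\<in>A. c i ^ 2)"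
    by (simp only: minus_complex.sel of_real_mult [symmetric] Re_complex_of_real)
  ultimately have "Re K \<le> 2 * T * (\<Sum>i\<in>A. c i ^ 2) + \<kappa> * ((\<Sum>i\<in>A. c i ^ 2) + (\<Sum>i\<in>A. c i ^ 2))"
    using complex_Re_le_cmod[of "K - complex_of_real (2 * T) * complex_of_real (\<Sum>i\<in>A. c i ^ 2)"] by linarith
  also have "\<dots> = (2 * T + 2 * \<kappa>) * (\<Sum>i\<in>A. c i ^ 2)" by (simp only: ring_distribs)
  also have "\<dots> \<le> (3 * T) * W" using \<kappa> \<kappa>' assms(5) T0 by (intro mult_mono sum_nonneg) auto
  finally have "Re K \<le> 3 * T * W" .
  moreover have "((\<lambda>t. norm (\<Sum>i\<in>A. (f (w i) * c i) * e (w i) t) ^ 2) has_integral Re K) {-T..T}"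
    using has_integral_Re[OF K(1)] by (simp only: complex_norm_square [symmetric] Re_complex_of_real)
  ultimately show ?thesis unfolding e_def by blast
qed

text \<open>Evaluate the integral of D R (cnj S) in two ways. From above it is at most V times the
  mean of the integrals of |R| ^ 2 and |S| ^ 2, hence at most 3 V T W. From below, the diagonal has
  f (n * u i) * cnj (f (v j)) = 1, because both arguments agree and |f| = 1. Each n has an
  off-diagonal error 2 \<kappa> W; the N errors together, divided by sqrt N, amount to 2 \<kappa>
  sqrt N W <= T W. Dividing by T turns this into the summand 1 next to 3 V.\<close>

lemma resonance_inequality:
  fixes f :: "nat \<Rightarrow> complex" and u :: "'i \<Rightarrow> nat" and v :: "'j \<Rightarrow> nat" and r :: "'i \<Rightarrow> real" and s :: "'j \<Rightarrow> real"
  assumes f: "completely_multiplicative f" "\<And>n. n \<ge> 1 \<Longrightarrow> norm (f n) = 1"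
    and fin: "finite I" "finite J" and inj: "inj_on u I" "inj_on v J"
    and u: "\<And>i. i \<in> I \<Longrightarrow> u i \<ge> 1 \<and> N * u i \<le> q"
    and v: "\<And>j. j \<in> J \<Longrightarrow> v j \<ge> 1 \<and> v j \<le> q"
    and W: "(\<Sum>i\<in>I. r i ^ 2) \<le> W" "(\<Sum>j\<in>J. s j ^ 2) \<le> W"
    and T: "4 * real q * (1 + ln (real q)) * sqrt (real N) \<le> T" and pos: "N \<ge> 1" "q \<ge> 1"
    and V: "\<And>t. \<bar>t\<bar> \<le> T \<Longrightarrow> norm (dirichlet_poly f N t) \<le> V"
  shows "2 * (1 / sqrt (real N) * (\<Sum>n=1..N. \<Sum>i\<in>I. \<Sum>j\<in>J. if n * u i = v j then r i * s j else 0)) \<le> (3 * V + 1) * W"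
proof -
  define e where "e = (\<lambda>n t. of_nat n powr (\<i> * complex_of_real t))"
  define \<kappa> where "\<kappa> = 2 * real q * (1 + ln (real q))"
  define R where "R = (\<lambda>t. \<Sum>i\<in>I. (f (u i) * r i) * e (u i) t)"
  define S where "S = (\<lambda>t. \<Sum>j\<in>J. (f (v j) * s j) * e (v j) t)"
  define D where "D = dirichlet_poly f N"
  define M where "M = (\<lambda>n. \<Sum>i\<in>I. \<Sum>j\<in>J. if n * u i = v j then r i * s j else 0)"
  have "\<kappa> \<ge> 0" unfolding \<kappa>_def using pos by (intro mult_nonneg_nonneg add_nonneg_nonneg) auto
  moreover have "2 * \<kappa> * sqrt (real N) = 4 * real q * (1 + ln (real q)) * sqrt (real N)"
    by (simp add: \<kappa>_def)
  ultimately have \<kappa>: "\<kappa> \<ge> 0" "2 * \<kappa> * sqrt (real N) \<le> T" using T by linarith+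
  hence "2 * \<kappa> * 1 \<le> 2 * \<kappa> * sqrt (real N)" using pos by (intro mult_left_mono) auto
  hence \<kappa>T: "2 * \<kappa> \<le> T" using \<kappa> by linarith
  hence T0: "T \<ge> 0" using \<kappa> by simp
  have "V \<ge> 0" using order.trans[OF norm_ge_zero V[of 0]] T0 by simp
  have "0 \<le> (\<Sum>i\<in>I. r i ^ 2)" by (intro sum_nonneg) auto
  hence "W \<ge> 0" using W(1) by linarith
  have uq: "u ` I \<subseteq> {1..q}"
  proof safe
    fix i assume "i \<in> I"
    thus "u i \<in> {1..q}" using le_trans[of "u i" "N * u i" q] pos u[of i] by simp
  qed
  have vq: "v ` J \<subseteq> {1..q}" using v by auto
  have mult_f: "f (m * n) = f m * f n" if "m \<ge> 1" "n \<ge> 1" for m n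
    using f(1) that by (simp add: completely_multiplicative_def)
  have mult_e: "e (m * n) t = e m t * e n t" for m n t
    by (simp add: e_def powr_times_real_left powr_times_real)
  have f_cnj: "f n * cnj (f n) = 1" if "n \<ge> 1" for n
    using f(2)[OF that] by (simp add: complex_norm_square [symmetric])

  obtain KR where KR: "((\<lambda>t. norm (R t) ^ 2) has_integral KR) {-T..T}" "KR \<le> 3 * T * W"
    using dirichlet_mean_square[where f = f, OF fin(1) inj(1) uq f(2) W(1) \<kappa>T[unfolded \<kappa>_def] pos(2)]
    unfolding R_def e_def by blast
  obtain KS where KS: "((\<lambda>t. norm (S t) ^ 2) has_integral KS) {-T..T}" "KS \<le> 3 * T * W"
    using dirichlet_mean_square[where f = f, OF fin(2) inj(2) vq f(2) W(2) \<kappa>T[unfolded \<kappa>_def] pos(2)]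
    unfolding S_def e_def by blast

  \<comment> \<open>The mean value theorem is applied to one n at a time: for fixed n the
    frequencies n * u i are distinct, while for varying n they may coincide. Complete
    multiplicativity merges f n * n^(it) into the coefficients of R.\<close>
  have "\<exists>K. ((\<lambda>t. f n * e n t * R t * cnj (S t)) has_integral K) {-T..T} \<and>
            norm (K - complex_of_real (2 * T) * of_real (M n)) \<le> 2 * \<kappa> * W" if n: "n \<in> {1..N}" for n
  proof -
    have inj': "inj_on (\<lambda>i. n * u i) I" using inj(1) n unfolding inj_on_def by simp
    have nq: "(\<lambda>i. n * u i) ` I \<subseteq> {1..q}"
    proof safe
      fix i assume i: "i \<in> I"
      have "n * u i \<le> N * u i" using n by (intro mult_right_mono) auto
      moreover have "1 * 1 \<le> n * u i" using n u[OF i] by (intro mult_mono) auto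
      ultimately show "n * u i \<in> {1..q}" using le_trans[of "n * u i" "N * u i" q] u[OF i] by simp
    qed
    obtain K where K: "((\<lambda>t. (\<Sum>i\<in>I. (f (n * u i) * r i) * e (n * u i) t) * cnj (\<Sum>j\<in>J. (f (v j) * s j) * e (v j) t)) has_integral K) {-T..T}"
      "norm (K - complex_of_real (2 * T) * (\<Sum>i\<in>I. \<Sum>j\<in>J. if n * u i = v j then (f (n * u i) * r i) * cnj (f (v j) * s j) else 0)) \<le>
       \<kappa> * ((\<Sum>i\<in>I. norm (f (n * u i) * r i) ^ 2) + (\<Sum>j\<in>J. norm (f (v j) * s j) ^ 2))"
      unfolding e_def \<kappa>_def
      by (rule dirichlet_mean_value[OF fin inj' inj(2) nq vq T0,
         where a = "\<lambda>i. f (n * u i) * r i" and b = "\<lambda>j. f (v j) * s j"])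
    have "(\<lambda>t. (\<Sum>i\<in>I. (f (n * u i) * r i) * e (n * u i) t) * cnj (\<Sum>j\<in>J. (f (v j) * s j) * e (v j) t)) =
          (\<lambda>t. f n * e n t * R t * cnj (S t))"
    proof
      fix t
      have "(\<Sum>i\<in>I. (f (n * u i) * r i) * e (n * u i) t) = f n * e n t * R t"
        unfolding R_def sum_distrib_left using n u
        by (intro sum.cong refl) (simp add: mult_f mult_e)
      thus "(\<Sum>i\<in>I. (f (n * u i) * r i) * e (n * u i) t) * cnj (\<Sum>j\<in>J. (f (v j) * s j) * e (v j) t) =
            f n * e n t * R t * cnj (S t)" by (simp add: S_def)
    qed
    moreover have "(\<Sum>i\<in>I. \<Sum>j\<in>J. if n * u i = v j then (f (n * u i) * r i) * cnj (f (v j) * s j) else 0) = of_real (M n)"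
      unfolding M_def of_real_sum
    proof (intro sum.cong refl)
      fix i j assume ij: "i \<in> I" "j \<in> J"
      have "(f (v j) * r i) * cnj (f (v j) * s j) = (f (v j) * cnj (f (v j))) * of_real (r i * s j)"
        by (simp only: complex_cnj_mult complex_cnj_complex_of_real of_real_mult mult_ac)
      also have "f (v j) * cnj (f (v j)) = 1" using f_cnj[of "v j"] v[OF ij(2)] by blast
      finally show "(if n * u i = v j then (f (n * u i) * r i) * cnj (f (v j) * s j) else 0) =
         of_real (if n * u i = v j then r i * s j else 0)" by simp
    qed
    moreover have "(\<Sum>i\<in>I. norm (f (n * u i) * r i) ^ 2) = (\<Sum>i\<in>I. r i ^ 2)"
      using f(2) nq by (intro sum.cong refl) (auto simp: norm_mult image_subset_iff)
    moreover have "(\<Sum>j\<in>J. norm (f (v j) * s j) ^ 2) = (\<Sum>j\<in>J. s j ^ 2)"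
      using f(2) vq by (intro sum.cong refl) (auto simp: norm_mult image_subset_iff)
    moreover have "\<kappa> * ((\<Sum>i\<in>I. r i ^ 2) + (\<Sum>j\<in>J. s j ^ 2)) \<le> \<kappa> * (W + W)"
      using W \<kappa> by (intro mult_left_mono add_mono) auto
    ultimately show ?thesis using K by (intro exI[of _ K]) auto
  qed
  then obtain K where K: "\<And>n. n \<in> {1..N} \<Longrightarrow> ((\<lambda>t. f n * e n t * R t * cnj (S t)) has_integral K n) {-T..T}"
      "\<And>n. n \<in> {1..N} \<Longrightarrow> norm (K n - complex_of_real (2 * T) * of_real (M n)) \<le> 2 * \<kappa> * W" by metis
  define z where "z = 1 / complex_of_real (sqrt (real N))"
  have "((\<lambda>t. z * (\<Sum>n=1..N. f n * e n t * R t * cnj (S t))) has_integral z * (\<Sum>n=1..N. K n)) {-T..T}"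
    using K by (intro has_integral_mult_right has_integral_sum) auto
  moreover have "z * (\<Sum>n=1..N. f n * e n t * R t * cnj (S t)) = D t * R t * cnj (S t)" for t
  proof -
    have "D t = z * (\<Sum>n=1..N. f n * e n t)" by (simp only: D_def dirichlet_poly_def z_def e_def)
    thus ?thesis by (simp only: sum_distrib_right mult.assoc)
  qed
  ultimately have int: "((\<lambda>t. D t * R t * cnj (S t)) has_integral z * (\<Sum>n=1..N. K n)) {-T..T}" by simp
  have bound: "((\<lambda>t. V / 2 * (norm (R t) ^ 2 + norm (S t) ^ 2)) has_integral V / 2 * (KR + KS)) {-T..T}"
    by (intro has_integral_mult_right has_integral_add KR KS)
  have "norm (D t * R t * cnj (S t)) \<le> V / 2 * (norm (R t) ^ 2 + norm (S t) ^ 2)" if "t \<in> {-T..T}" for t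
  proof -
    have "norm (D t * R t * cnj (S t)) = norm (D t) * (norm (R t) * norm (S t))" by (simp add: norm_mult)
    also have "\<dots> \<le> V * ((norm (R t) ^ 2 + norm (S t) ^ 2) / 2)"
      using V[of t] that sum_squares_bound[of "norm (R t)" "norm (S t)"] \<open>V \<ge> 0\<close>
      by (intro mult_mono) (auto simp: D_def)
    finally show ?thesis by simp
  qed
  hence "norm (z * (\<Sum>n=1..N. K n)) \<le> V / 2 * (KR + KS)"
    using has_integral_norm_bound_integral_component[OF int bound, where k = 1] by simp
  also have "\<dots> \<le> V / 2 * (3 * T * W + 3 * T * W)"
    using KR KS \<open>V \<ge> 0\<close> by (intro mult_left_mono add_mono) auto
  finally have upper: "norm (\<Sum>n=1..N. K n) / sqrt (real N) \<le> 3 * V * T * W"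
    by (simp add: z_def norm_mult norm_divide mult_ac)
  have "norm (\<Sum>n=1..N. K n - complex_of_real (2 * T) * of_real (M n)) \<le> (\<Sum>n=1..N. 2 * \<kappa> * W)"
    by (intro order.trans[OF norm_sum] sum_mono K)
  hence "norm (of_real (2 * T * (\<Sum>n=1..N. M n)) - (\<Sum>n=1..N. K n)) \<le> real N * (2 * \<kappa> * W)"
    by (simp add: sum_subtractf sum_distrib_left norm_minus_commute)
  hence "2 * T * (\<Sum>n=1..N. M n) \<le> norm (\<Sum>n=1..N. K n) + real N * (2 * \<kappa> * W)"
    using norm_triangle_sub[of "of_real (2 * T * (\<Sum>n=1..N. M n))" "\<Sum>n=1..N. K n"]
      complex_Re_le_cmod[of "of_real (2 * T * (\<Sum>n=1..N. M n))"] by (simp only: Re_complex_of_real)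
  hence "2 * T * (\<Sum>n=1..N. M n) / sqrt (real N) \<le> (norm (\<Sum>n=1..N. K n) + real N * (2 * \<kappa> * W)) / sqrt (real N)"
    by (rule divide_right_mono) simp
  also have "\<dots> = norm (\<Sum>n=1..N. K n) / sqrt (real N) + 2 * \<kappa> * sqrt (real N) * W"
  proof -
    have "real N * (2 * \<kappa> * W) / sqrt (real N) = 2 * \<kappa> * W * (real N / sqrt (real N))" by simp
    also have "real N / sqrt (real N) = sqrt (real N)" by (intro real_div_sqrt) simp
    finally show ?thesis by (simp add: add_divide_distrib mult_ac)
  qed
  also have "\<dots> \<le> 3 * V * T * W + T * W"
    using upper \<kappa> \<open>W \<ge> 0\<close> by (intro add_mono mult_right_mono) auto
  finally have "T * (2 * (1 / sqrt (real N) * (\<Sum>n=1..N. M n))) \<le> T * ((3 * V + 1) * W)"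
    by (simp add: algebra_simps)
  moreover have "T > 0"
  proof -
    have "0 < 4 * real q * (1 + ln (real q)) * sqrt (real N)"
      using pos by (intro mult_pos_pos add_pos_nonneg) auto
    thus ?thesis using T by linarith
  qed
  ultimately show ?thesis unfolding M_def by (simp only: mult_le_cancel_left_pos)
qed

section \<open>The resonator\<close>

text \<open>Linearity of expectation for the product weights. The true mean of \<open>g p\<close> is
  the sum of g p i * v p i divided by the total weight at p. As this total is at least 1, the
  quotient may be replaced by its numerator.\<close>

lemma sum_PiE_additive_le:
  fixes v g :: "'a \<Rightarrow> 'b \<Rightarrow> real"
  assumes "finite P" "finite K"
    and v: "\<And>p i. p \<in> P \<Longrightarrow> i \<in> K \<Longrightarrow> v p i \<ge> 0" "\<And>p. p \<in> P \<Longrightarrow> (\<Sum>i\<in>K. v p i) \<ge> 1"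
    and g: "\<And>p i. p \<in> P \<Longrightarrow> i \<in> K \<Longrightarrow> g p i \<ge> 0"
  shows "(\<Sum>h\<in>P \<rightarrow>\<^sub>E K. (\<Sum>p\<in>P. g p (h p)) * (\<Prod>p\<in>P. v p (h p))) \<le>
         (\<Sum>p\<in>P. \<Sum>i\<in>K. g p i * v p i) * (\<Prod>p\<in>P. \<Sum>i\<in>K. v p i)"
proof -
  have "(\<Sum>h\<in>P \<rightarrow>\<^sub>E K. g p (h p) * (\<Prod>q\<in>P. v q (h q))) \<le>
        (\<Sum>i\<in>K. g p i * v p i) * (\<Prod>q\<in>P. \<Sum>i\<in>K. v q i)" if p: "p \<in> P" for p
  proof -
    have "(\<Sum>h\<in>P \<rightarrow>\<^sub>E K. g p (h p) * (\<Prod>q\<in>P. v q (h q))) =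
          (\<Sum>h\<in>P \<rightarrow>\<^sub>E K. (\<Prod>q\<in>P. (if q = p then g p (h q) else 1) * v q (h q)))"
      using p assms(1) by (intro sum.cong refl) (simp add: prod.distrib prod.delta)
    also have "\<dots> = (\<Prod>q\<in>P. \<Sum>i\<in>K. (if q = p then g p i else 1) * v q i)"
      using assms(1,2) by (subst prod_sum_PiE) auto
    also have "\<dots> = (\<Sum>i\<in>K. g p i * v p i) * (\<Prod>q\<in>P - {p}. \<Sum>i\<in>K. v q i)"
      using p assms(1) by (subst prod.remove[OF _ p]) auto
    also have "\<dots> \<le> (\<Sum>i\<in>K. g p i * v p i) * ((\<Sum>i\<in>K. v p i) * (\<Prod>q\<in>P - {p}. \<Sum>i\<in>K. v q i))"
    proof (rule mult_left_mono)
      have "1 * (\<Prod>q\<in>P - {p}. \<Sum>i\<in>K. v q i) \<le> (\<Sum>i\<in>K. v p i) * (\<Prod>q\<in>P - {p}. \<Sum>i\<in>K. v q i)"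
        using v p by (intro mult_right_mono prod_nonneg sum_nonneg) auto
      thus "(\<Prod>q\<in>P - {p}. \<Sum>i\<in>K. v q i) \<le> (\<Sum>i\<in>K. v p i) * (\<Prod>q\<in>P - {p}. \<Sum>i\<in>K. v q i)" by simp
    qed (use p v g in \<open>auto intro!: sum_nonneg\<close>)
    also have "\<dots> = (\<Sum>i\<in>K. g p i * v p i) * (\<Prod>q\<in>P. \<Sum>i\<in>K. v q i)"
      using prod.remove[OF assms(1) p, of "\<lambda>q. \<Sum>i\<in>K. v q i"] by simp
    finally show ?thesis .
  qed
  hence "(\<Sum>p\<in>P. \<Sum>h\<in>P \<rightarrow>\<^sub>E K. g p (h p) * (\<Prod>q\<in>P. v q (h q))) \<le>
         (\<Sum>p\<in>P. (\<Sum>i\<in>K. g p i * v p i) * (\<Prod>q\<in>P. \<Sum>i\<in>K. v q i))" by (rule sum_mono)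
  thus ?thesis by (subst (asm) sum.swap) (simp only: sum_distrib_right)
qed

text \<open>Markov's inequality for the product measure with weights proportional to \<open>v p\<close>, unnormalised.\<close>

lemma sum_PiE_markov:
  fixes v g :: "'a \<Rightarrow> 'b \<Rightarrow> real"
  assumes "finite P" "finite K"
    and v: "\<And>p i. p \<in> P \<Longrightarrow> i \<in> K \<Longrightarrow> v p i \<ge> 0" "\<And>p. p \<in> P \<Longrightarrow> (\<Sum>i\<in>K. v p i) \<ge> 1"
    and g: "\<And>p i. p \<in> P \<Longrightarrow> i \<in> K \<Longrightarrow> g p i \<ge> 0"
  shows "(\<Sum>h | h \<in> P \<rightarrow>\<^sub>E K \<and> (\<Sum>p\<in>P. g p (h p)) \<le> 1. \<Prod>p\<in>P. v p (h p)) \<ge>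
         (1 - (\<Sum>p\<in>P. \<Sum>i\<in>K. g p i * v p i)) * (\<Prod>p\<in>P. \<Sum>i\<in>K. v p i)"
proof -
  let ?H = "P \<rightarrow>\<^sub>E K" and ?G = "\<lambda>h. \<Sum>p\<in>P. g p (h p)" and ?w = "\<lambda>h. \<Prod>p\<in>P. v p (h p)"
  have finH: "finite ?H" using assms(1,2) by (intro finite_PiE) auto
  have w: "?w h \<ge> 0" if "h \<in> ?H" for h using that v by (intro prod_nonneg) auto
  have G: "?G h \<ge> 0" if "h \<in> ?H" for h using that g by (intro sum_nonneg) auto
  have "(\<Prod>p\<in>P. \<Sum>i\<in>K. v p i) = (\<Sum>h\<in>?H. ?w h)"
    using assms(1,2) by (subst prod_sum_PiE) auto
  \<comment> \<open>Pointwise, for G >= 0, the number 1 is at most the indicator of G <= 1 plus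
    G.\<close>
  also have "\<dots> \<le> (\<Sum>h\<in>?H. (if ?G h \<le> 1 then ?w h else 0) + ?G h * ?w h)"
  proof (rule sum_mono)
    fix h assume h: "h \<in> ?H"
    have "?w h \<le> ?G h * ?w h" if "?G h > 1"
      using mult_right_mono[of 1 "?G h" "?w h"] that w[OF h] by simp
    thus "?w h \<le> (if ?G h \<le> 1 then ?w h else 0) + ?G h * ?w h"
      using w[OF h] G[OF h] by auto
  qed
  also have "\<dots> = (\<Sum>h | h \<in> ?H \<and> ?G h \<le> 1. ?w h) + (\<Sum>h\<in>?H. ?G h * ?w h)"
    using finH by (simp add: sum.distrib sum.inter_filter)
  also have "\<dots> \<le> (\<Sum>h | h \<in> ?H \<and> ?G h \<le> 1. ?w h) + (\<Sum>p\<in>P. \<Sum>i\<in>K. g p i * v p i) * (\<Prod>p\<in>P. \<Sum>i\<in>K. v p i)"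
    using assms by (intro add_left_mono sum_PiE_additive_le) auto
  finally show ?thesis by (simp add: algebra_simps)
qed

lemma prod_primes_eq_imp_eq:
  assumes "finite A" "finite B" "\<And>p. p \<in> A \<Longrightarrow> prime p" "\<And>p. p \<in> B \<Longrightarrow> prime (p::nat)" "\<Prod>A = \<Prod>B"
  shows "A = B"
proof -
  have *: "p \<in> X \<longleftrightarrow> prime p \<and> p dvd \<Prod>X" if "finite X" "\<And>p. p \<in> X \<Longrightarrow> prime p" for X and p :: nat
    using that prime_dvd_prod_iff[of X p "\<lambda>x. x"] primes_dvd_imp_eq[of p] by (auto simp: dvd_prodI)
  show ?thesis
  proof (rule set_eqI)
    fix p
    show "p \<in> A \<longleftrightarrow> p \<in> B"
      using *[OF assms(1,3), of p] *[OF assms(2,4), of p] assms(5) by simp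
  qed
qed

lemma inj_on_prod_primes:
  assumes "\<And>p. p \<in> P \<Longrightarrow> prime (p::nat)" "finite P"
  shows "inj_on (\<lambda>A. \<Prod>A) (Pow P)"
proof (rule inj_onI)
  fix A B assume *: "A \<in> Pow P" "B \<in> Pow P" "\<Prod>A = \<Prod>B"
  hence "finite A" "finite B" using assms(2) by (auto intro: finite_subset)
  thus "A = B" by (rule prod_primes_eq_imp_eq) (use * assms(1) in auto)
qed

text \<open>The prime k is recognisable in the product as its only factor outside P.\<close>

lemma inj_on_mult_prod_primes:
  assumes "\<And>p. p \<in> P \<Longrightarrow> prime (p::nat)" "finite P" "\<And>k. k \<in> K \<Longrightarrow> prime k \<and> k \<notin> P"
  shows "inj_on (\<lambda>(k, A). k * \<Prod>A) (K \<times> Pow P)"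
proof (rule inj_onI, clarify)
  fix k A l B assume *: "k \<in> K" "A \<subseteq> P" "l \<in> K" "B \<subseteq> P" "k * \<Prod>A = l * \<Prod>B"
  have fin: "finite A" "finite B" using * assms(2) by (auto intro: finite_subset)
  have "\<Prod>(insert k A) = k * \<Prod>A" "\<Prod>(insert l B) = l * \<Prod>B" using * fin assms(3) by (auto simp: prod.insert_if)
  hence "insert k A = insert l B"
    using * fin assms by (intro prod_primes_eq_imp_eq) auto
  moreover have "k \<notin> P" "l \<notin> P" using * assms(3) by auto
  moreover from this have "k \<notin> A" "k \<notin> B" "l \<notin> A" "l \<notin> B" using * by auto
  ultimately show "k = l \<and> A = B" by (metis insertE insertI1 insert_ident)
qed

lemma sqrt_prod: "sqrt (\<Prod>x\<in>A. f x) = (\<Prod>x\<in>A. sqrt (f x))"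
  by (induction A rule: infinite_finite_induct) (simp_all add: real_sqrt_mult)

text \<open>The solutions of n * u A = v (k, B) that are used have A contained in B and n = k b,
  where b is the product of B - A. Such a solution has weight R A ^ 2 * R (B - A) / sqrt k. Summing
  over k <= N / b gives at least \<kappa> sqrt N times R A ^ 2 * R (B - A) / sqrt b. Without size
  restrictions, the sum over disjoint pairs A, B - A would be the Euler product with factors 1 + r p
  ^ 2 + r p / sqrt p. Markov's inequality keeps a fraction \<theta> of it.\<close>

lemma resonator_lower_bound:
  fixes P K :: "nat set" and r :: "nat \<Rightarrow> real" and N q :: nat and M \<kappa> :: real
  assumes f: "completely_multiplicative f" "\<And>n. n \<ge> 1 \<Longrightarrow> norm (f n) = 1"
    and P: "finite P" "\<And>p. p \<in> P \<Longrightarrow> prime p" "\<And>p. p \<in> P \<Longrightarrow> r p \<ge> 0"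
    and K: "\<And>k. k \<in> K \<Longrightarrow> prime k \<and> k \<notin> P \<and> k \<le> N"
    and \<kappa>: "\<kappa> \<ge> 0" "\<And>x. sqrt (real N) \<le> x \<Longrightarrow> x \<le> real N \<Longrightarrow>
              (\<Sum>k | k \<in> K \<and> real k \<le> x. 1 / sqrt (real k)) \<ge> \<kappa> * sqrt x"
    and M: "M > 1" "N > 1" "real N * M \<le> real q"
    and \<theta>: "(\<Sum>p\<in>P. r p ^ 2 * (ln p / ln M) + r p / sqrt p * (ln p / ln M + 2 * ln p / ln N)) \<le> 1 - \<theta>"
    and T: "4 * real q * (1 + ln (real q)) * sqrt (real N) \<le> T"
    and V: "\<And>t. \<bar>t\<bar> \<le> T \<Longrightarrow> norm (dirichlet_poly f N t) \<le> V"
  shows "2 * \<kappa> * \<theta> * (\<Prod>p\<in>P. 1 + r p ^ 2 + r p / sqrt p) \<le> (3 * V + 1) * ((1 + ln N) * (\<Prod>p\<in>P. 1 + r p ^ 2))"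
proof -
  define R where "R = (\<lambda>A. \<Prod>p\<in>A. r p)"
  define I where "I = {A \<in> Pow P. real (\<Prod>A) \<le> M}"
  define J where "J = K \<times> I"
  define u where "u = (\<lambda>A::nat set. \<Prod>A)"
  define v where "v = (\<lambda>(k::nat, A::nat set). k * \<Prod>A)"
  define s where "s = (\<lambda>(k::nat, A). R A / sqrt k)"
  \<comment> \<open>A common bound for both square sums. The factor 1 + ln N bounds the sum of 1 / k
    that \<open>S\<close> contributes.\<close>
  define W where "W = (1 + ln N) * (\<Prod>p\<in>P. 1 + r p ^ 2)"
  \<comment> \<open>A pair \<open>(m, n)\<close> of coprime divisors of \<open>\<Prod>P\<close> is encoded by \<open>h\<close>: \<open>h p\<close> is 1 if \<open>p\<close> divides \<open>m\<close>,
    2 if it divides \<open>n\<close>, 0 otherwise. Membership in \<open>H\<close> forces both \<open>m n \<le> M\<close> and \<open>n \<le> sqrt N\<close>, since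
    the two normalised logarithms add up to at most 1.\<close>
  define wt where "wt = (\<lambda>p (i::nat). if i = 0 then 1 else if i = 1 then r p ^ 2 else r p / sqrt p)"
  define g where "g = (\<lambda>p (i::nat). if i = 0 then 0 else if i = 1 then ln p / ln M else ln p / ln M + 2 * ln p / ln N)"
  define H where "H = {h \<in> P \<rightarrow>\<^sub>E {0, 1, 2::nat}. (\<Sum>p\<in>P. g p (h p)) \<le> 1}"
  define S where "S = (\<lambda>(h::nat \<Rightarrow> nat) i. {p \<in> P. h p = i})"
  have finK: "finite K" using K by (intro finite_subset[of K "{..N}"]) auto
  have I: "finite I" "I \<subseteq> Pow P" using P by (auto simp: I_def)
  have finJ: "finite J" using finK I by (simp add: J_def)
  have fin: "finite A" if "A \<subseteq> P" for A using that P finite_subset by blast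
  have P1: "p \<ge> 1" if "p \<in> P" for p using P(2)[OF that] prime_ge_1_nat by blast
  have prod_ge: "\<Prod>A \<ge> 1" if "A \<subseteq> P" for A using that P1 by (intro prod_ge_1) auto
  have finS: "finite (S h i)" "S h i \<subseteq> P" for h i using P by (auto simp: S_def)
  have R_nonneg: "R A \<ge> 0" if "A \<subseteq> P" for A using that P by (auto simp: R_def intro!: prod_nonneg)
  have sumR: "(\<Sum>A\<in>I. R A ^ 2) \<le> (\<Prod>p\<in>P. 1 + r p ^ 2)"
  proof -
    have "(\<Sum>A\<in>I. R A ^ 2) \<le> (\<Sum>A\<in>Pow P. R A ^ 2)" using P I by (intro sum_mono2) auto
    also have "\<dots> = (\<Prod>p\<in>P. r p ^ 2 + 1)"
      using P(1) by (subst prod_add) (auto simp: R_def prod_power_distrib)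
    finally show ?thesis by (simp add: add.commute)
  qed
  have prod_pos': "(\<Prod>p\<in>P. 1 + r p ^ 2) \<ge> 0" by (intro prod_nonneg) auto
  have W1: "(\<Sum>A\<in>I. R A ^ 2) \<le> W"
  proof -
    have "1 * (\<Prod>p\<in>P. 1 + r p ^ 2) \<le> W"
      unfolding W_def using M prod_pos' by (intro mult_right_mono) auto
    thus ?thesis using sumR by simp
  qed
  have W2: "(\<Sum>j\<in>J. s j ^ 2) \<le> W"
  proof -
    have "(\<Sum>j\<in>J. s j ^ 2) = (\<Sum>k\<in>K. 1 / real k) * (\<Sum>A\<in>I. R A ^ 2)"
      unfolding sum_product sum.cartesian_product J_def
      by (intro sum.cong) (auto simp: s_def power_divide)
    also have "\<dots> \<le> (1 + ln N) * (\<Prod>p\<in>P. 1 + r p ^ 2)"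
    proof (intro mult_mono sumR)
      have "(\<Sum>k\<in>K. 1 / real k) \<le> (\<Sum>k=1..N. 1 / real k)"
        using K prime_ge_1_nat by (intro sum_mono2) auto
      also have "\<dots> = harm N" by (simp add: harm_def inverse_eq_divide)
      also have "\<dots> \<le> 1 + ln N"
        using M by (intro harm_le_ln) simp
      finally show "(\<Sum>k\<in>K. 1 / real k) \<le> 1 + ln N" .
    qed (use M in \<open>auto intro!: sum_nonneg\<close>)
    finally show ?thesis by (simp add: W_def)
  qed
  have inj_u: "inj_on u I"
    unfolding u_def by (rule inj_on_subset[OF inj_on_prod_primes[OF P(2,1)] I(2)])
  have "inj_on v (K \<times> Pow P)" unfolding v_def by (rule inj_on_mult_prod_primes[OF P(2,1)]) (use K in blast)+
  hence inj_v: "inj_on v J" by (rule inj_on_subset) (use I in \<open>auto simp: J_def\<close>)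
  have q: "q \<ge> 1" using M by (cases "q = 0") (auto simp: zero_less_mult_iff mult_le_0_iff)
  have Nu: "real (N * \<Prod>A) \<le> real q" if "A \<in> I" for A
  proof -
    have "real N * real (\<Prod>A) \<le> real N * M" using that by (intro mult_left_mono) (auto simp: I_def)
    thus ?thesis using M(3) by (simp only: of_nat_mult)
  qed
  have u: "u A \<ge> 1 \<and> N * u A \<le> q" if "A \<in> I" for A
  proof -
    have "A \<subseteq> P" using that I(2) by auto
    thus ?thesis using Nu[OF that] prod_ge[of A] unfolding u_def by (simp only: of_nat_le_iff)
  qed
  have v: "v j \<ge> 1 \<and> v j \<le> q" if "j \<in> J" for j
  proof -
    obtain k A where j: "j = (k, A)" "k \<in> K" "A \<in> I"
      using \<open>j \<in> J\<close> by (cases j) (auto simp: J_def)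
    have "k * \<Prod>A \<le> N * \<Prod>A" using K[OF j(2)] by (intro mult_right_mono) auto
    moreover have "1 * 1 \<le> k * \<Prod>A"
      using K[OF j(2)] prod_ge[of A] I j(3) prime_ge_1_nat by (intro mult_mono) auto
    ultimately show ?thesis using u[OF j(3)] le_trans[of "k * \<Prod>A" "N * \<Prod>A" q]
      unfolding u_def v_def j(1) by simp
  qed
  have main: "2 * (1 / sqrt (real N) * (\<Sum>n=1..N. \<Sum>A\<in>I. \<Sum>j\<in>J. if n * u A = v j then R A * s j else 0)) \<le> (3 * V + 1) * W"
    by (rule resonance_inequality[where f = f and q = q and T = T and u = u and v = v and r = R and s = s])
       (use f I(1) finJ inj_u inj_v u v W1 W2 T M q V in auto)

  have SH: "\<Prod>(S h 1) * \<Prod>(S h 2) = \<Prod>(S h 1 \<union> S h 2)" "R (S h 1) * R (S h 2) = R (S h 1 \<union> S h 2)" for h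
    unfolding R_def using finS by (subst prod.union_disjoint; auto simp: S_def)+
  have ln_prod: "ln (real (\<Prod>A)) = (\<Sum>p\<in>A. ln (real p))" if "A \<subseteq> P" for A
    using that fin[OF that] P1 by (simp add: ln_prod subset_iff Suc_le_eq)
  have restr: "(\<Sum>p\<in>P. if p \<in> A then t p else 0) = (\<Sum>p\<in>A. t p)" if "A \<subseteq> P"
    for A and t :: "nat \<Rightarrow> real"
    using P(1) that by (subst sum.inter_restrict [symmetric]) (auto simp: Int_absorb1)
  have H: "real (\<Prod>(S h 1 \<union> S h 2)) \<le> M" "real (\<Prod>(S h 2)) \<le> sqrt N" if h: "h \<in> H" for h
  proof -
    have "(\<Sum>p\<in>P. g p (h p)) = (\<Sum>p\<in>P. (if p \<in> S h 1 \<union> S h 2 then ln p / ln M else 0) + (if p \<in> S h 2 then 2 * ln p / ln N else 0))"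
      using h by (intro sum.cong) (auto simp: g_def H_def S_def PiE_iff)
    also have "\<dots> = (\<Sum>p\<in>S h 1 \<union> S h 2. ln p / ln M) + (\<Sum>p\<in>S h 2. 2 * ln p / ln N)"
      using finS(2)[of h] by (simp only: sum.distrib restr Un_least)
    also have "\<dots> = ln (real (\<Prod>(S h 1 \<union> S h 2))) / ln M + 2 * ln (real (\<Prod>(S h 2))) / ln N"
      using finS(2)[of h] by (simp only: ln_prod Un_least sum_divide_distrib sum_distrib_left)
    finally have le: "ln (real (\<Prod>(S h 1 \<union> S h 2))) / ln M + 2 * ln (real (\<Prod>(S h 2))) / ln N \<le> 1"
      using h by (simp add: H_def)
    have ge: "\<Prod>(S h 1 \<union> S h 2) \<ge> 1" "\<Prod>(S h 2) \<ge> 1" using finS by (intro prod_ge; auto)+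
    have nn: "ln (real (\<Prod>(S h 1 \<union> S h 2))) / ln M \<ge> 0" "2 * ln (real (\<Prod>(S h 2))) / ln N \<ge> 0"
      using ge M by (auto intro!: divide_nonneg_nonneg mult_nonneg_nonneg simp del: of_nat_prod)
    have "ln (real (\<Prod>(S h 1 \<union> S h 2))) / ln M \<le> 1" using le nn by linarith
    hence "ln (real (\<Prod>(S h 1 \<union> S h 2))) \<le> ln M" using M by (simp add: divide_le_eq del: of_nat_prod)
    thus "real (\<Prod>(S h 1 \<union> S h 2)) \<le> M" using ge M by (subst (asm) ln_le_cancel_iff) (auto simp del: of_nat_prod)
    have "2 * ln (real (\<Prod>(S h 2))) / ln N \<le> 1" using le nn by linarith
    hence "ln (real (\<Prod>(S h 2))) \<le> ln (sqrt N)" using M by (simp add: divide_le_eq ln_sqrt del: of_nat_prod)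
    thus "real (\<Prod>(S h 2)) \<le> sqrt N" using ge M by (subst (asm) ln_le_cancel_iff) (auto simp del: of_nat_prod)
  qed
  \<comment> \<open>A lower bound for the sum over all solutions \<open>X\<close> needs only an
    injection into \<open>X\<close> with the right weights; \<open>F\<close> maps a restricted pair
    together with an admissible k to its solution.\<close>
  define Y where "Y = (SIGMA h:H. {k \<in> K. real k \<le> real N / real (\<Prod>(S h 2))})"
  define X where "X = {(n, A, j). n \<in> {1..N} \<and> A \<in> I \<and> j \<in> J \<and> n * u A = v j}"
  define F where "F = (\<lambda>(h, k). (k * \<Prod>(S h 2), S h 1, (k, S h 1 \<union> S h 2)))"
  have finH: "finite H" unfolding H_def using P by (intro finite_subset[OF _ finite_PiE[of P "\<lambda>_. {0,1,2}"]]) auto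
  have finX: "finite X"
    by (rule finite_subset[of _ "{1..N} \<times> I \<times> J"]) (use I finJ in \<open>auto simp: X_def\<close>)
  have inj_F: "inj_on F Y"
  proof (rule inj_onI)
    fix y y' assume yy: "y \<in> Y" "y' \<in> Y" "F y = F y'"
    obtain h k h' k' where y: "y = (h, k)" "y' = (h', k')" by (cases y, cases y') auto
    have hh: "h \<in> P \<rightarrow>\<^sub>E {0, 1, 2}" "h' \<in> P \<rightarrow>\<^sub>E {0, 1, 2}" using yy by (auto simp: y Y_def H_def)
    have eq: "k = k'" "S h 1 = S h' 1" "S h 1 \<union> S h 2 = S h' 1 \<union> S h' 2" using yy(3) by (auto simp: y F_def)
    have "S h 1 \<inter> S h 2 = {}" "S h' 1 \<inter> S h' 2 = {}" by (auto simp: S_def)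
    hence eq2: "S h 2 = S h' 2" using eq by blast
    have "h p = h' p" for p
    proof (cases "p \<in> P")
      case True
      hence "h p \<in> {0, 1, 2}" "h' p \<in> {0, 1, 2}" using hh by (auto simp: PiE_iff)
      moreover have "h p = 1 \<longleftrightarrow> h' p = 1" "h p = 2 \<longleftrightarrow> h' p = 2" using True eq(2) eq2 by (auto simp: S_def)
      ultimately show ?thesis by auto
    next
      case False
      thus ?thesis using hh by (auto simp: PiE_iff extensional_def)
    qed
    thus "y = y'" using eq by (auto simp: y)
  qed
  have F_X: "F ` Y \<subseteq> X"
  proof (rule image_subsetI)
    fix y assume "y \<in> Y"
    then obtain h k where y: "y = (h, k)" and h: "h \<in> H" and k: "k \<in> K" "real k \<le> real N / real (\<Prod>(S h 2))"
      by (cases y) (auto simp: Y_def)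
    have ge: "\<Prod>(S h 1) \<ge> 1" "\<Prod>(S h 2) \<ge> 1" using finS by (intro prod_ge; auto)+
    have "real (k * \<Prod>(S h 2)) \<le> real N" using k ge by (simp add: field_simps del: of_nat_prod)
    hence "k * \<Prod>(S h 2) \<le> N" by (simp only: of_nat_le_iff)
    moreover have "1 * 1 \<le> k * \<Prod>(S h 2)" using ge K[OF k(1)] prime_ge_1_nat by (intro mult_mono) auto
    moreover have I12: "S h 1 \<union> S h 2 \<in> I" using H[OF h] finS by (simp add: I_def)
    moreover have "S h 1 \<in> I"
    proof -
      have "\<Prod>(S h 1) * 1 \<le> \<Prod>(S h 1 \<union> S h 2)" unfolding SH(1) [symmetric] using ge by (intro mult_left_mono) auto
      hence "real (\<Prod>(S h 1)) \<le> real (\<Prod>(S h 1 \<union> S h 2))" by (simp only: of_nat_le_iff mult_1_right)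
      thus ?thesis using H[OF h] finS unfolding I_def by auto
    qed
    moreover have "k * \<Prod>(S h 2) * u (S h 1) = v (k, S h 1 \<union> S h 2)"
      by (simp only: u_def v_def prod.case SH(1) [symmetric] mult_ac)
    ultimately show "F y \<in> X" using k(1) by (simp add: y F_def X_def J_def)
  qed
  have XR_nonneg: "R A * s j \<ge> 0" if "A \<in> I" "j \<in> J" for A j
    using that I R_nonneg by (auto simp: s_def J_def intro!: mult_nonneg_nonneg divide_nonneg_nonneg)
  \<comment> \<open>The Euler product is turned step by step into the diagonal sum: Markov, the sum
    over k, and the injection \<open>F\<close>.\<close>
  have "\<kappa> * sqrt N * (\<theta> * (\<Prod>p\<in>P. 1 + r p ^ 2 + r p / sqrt p)) \<le> \<kappa> * sqrt N * (\<Sum>h\<in>H. \<Prod>p\<in>P. wt p (h p))"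
  proof (rule mult_left_mono)
    have "(1 - (\<Sum>p\<in>P. \<Sum>i\<in>{0,1,2}. g p i * wt p i)) * (\<Prod>p\<in>P. \<Sum>i\<in>{0,1,2}. wt p i) \<le> (\<Sum>h\<in>H. \<Prod>p\<in>P. wt p (h p))"
      unfolding H_def
    proof (rule sum_PiE_markov)
      show "wt p i \<ge> 0" "g p i \<ge> 0" if "p \<in> P" for p i
        using that P(3) P1 M by (auto simp: wt_def g_def intro!: add_nonneg_nonneg divide_nonneg_nonneg)
      show "(\<Sum>i\<in>{0,1,2}. wt p i) \<ge> 1" if "p \<in> P" for p
        using that P(3)[OF that] by (auto simp: wt_def intro!: add_nonneg_nonneg)
    qed (use P in auto)
    moreover have "(\<Prod>p\<in>P. \<Sum>i\<in>{0,1,2}. wt p i) = (\<Prod>p\<in>P. 1 + r p ^ 2 + r p / sqrt p)"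
      by (simp add: wt_def add.assoc)
    moreover have "(\<Sum>p\<in>P. \<Sum>i\<in>{0,1,2}. g p i * wt p i) \<le> 1 - \<theta>"
      using \<theta> by (simp add: wt_def g_def mult_ac)
    moreover have "(\<Prod>p\<in>P. 1 + r p ^ 2 + r p / sqrt p) \<ge> 0"
      using P(3) by (intro prod_nonneg) auto
    ultimately show "\<theta> * (\<Prod>p\<in>P. 1 + r p ^ 2 + r p / sqrt p) \<le> (\<Sum>h\<in>H. \<Prod>p\<in>P. wt p (h p))"
      using mult_right_mono[of \<theta> "1 - (\<Sum>p\<in>P. \<Sum>i\<in>{0,1,2}. g p i * wt p i)" "\<Prod>p\<in>P. 1 + r p ^ 2 + r p / sqrt p"]
      by simp
  qed (use \<kappa> in auto)
  also have "\<dots> = (\<Sum>h\<in>H. R (S h 1) ^ 2 * R (S h 2) * (\<kappa> * sqrt (real N / real (\<Prod>(S h 2)))))"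
    unfolding sum_distrib_left
  proof (rule sum.cong[OF refl])
    fix h assume h: "h \<in> H"
    have "(\<Prod>p\<in>P. wt p (h p)) = (\<Prod>p\<in>P. (if p \<in> S h 1 then r p ^ 2 else 1) * (if p \<in> S h 2 then r p / sqrt p else 1))"
      using h by (intro prod.cong) (auto simp: wt_def H_def S_def PiE_iff)
    also have "\<dots> = (\<Prod>p\<in>S h 1. r p ^ 2) * (\<Prod>p\<in>S h 2. r p / sqrt p)"
      using P finS(2)[of h] by (simp add: prod.distrib prod.inter_restrict [symmetric] Int_absorb1)
    also have "\<dots> = R (S h 1) ^ 2 * R (S h 2) / sqrt (real (\<Prod>(S h 2)))"
      by (simp add: R_def prod_power_distrib prod_dividef sqrt_prod)
    finally show "\<kappa> * sqrt N * (\<Prod>p\<in>P. wt p (h p)) = R (S h 1) ^ 2 * R (S h 2) * (\<kappa> * sqrt (real N / real (\<Prod>(S h 2))))"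
      by (simp add: real_sqrt_divide)
  qed
  \<comment> \<open>Here the restriction b <= sqrt N is used: it keeps N / b between sqrt N and N,
    the range in which the sum over k is controlled.\<close>
  also have "\<dots> \<le> (\<Sum>h\<in>H. R (S h 1) ^ 2 * R (S h 2) * (\<Sum>k | k \<in> K \<and> real k \<le> real N / real (\<Prod>(S h 2)). 1 / sqrt (real k)))"
  proof (intro sum_mono mult_left_mono \<kappa>(2))
    fix h assume h: "h \<in> H"
    have ge: "\<Prod>(S h 2) \<ge> 1" using finS by (intro prod_ge) auto
    have "sqrt N * real (\<Prod>(S h 2)) \<le> sqrt N * sqrt N" using H(2)[OF h] by (intro mult_left_mono) auto
    thus "sqrt N \<le> real N / real (\<Prod>(S h 2))" using ge by (simp add: pos_le_divide_eq del: of_nat_prod)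
    have "real N * 1 \<le> real N * real (\<Prod>(S h 2))" using ge by (intro mult_left_mono) (auto simp del: of_nat_prod)
    thus "real N / real (\<Prod>(S h 2)) \<le> real N" using ge by (simp add: pos_divide_le_eq del: of_nat_prod)
    show "R (S h 1) ^ 2 * R (S h 2) \<ge> 0" using R_nonneg finS by (intro mult_nonneg_nonneg) auto
  qed
  also have "\<dots> = (\<Sum>(h, k)\<in>Y. R (S h 1) ^ 2 * R (S h 2) * (1 / sqrt (real k)))"
    unfolding sum_distrib_left Y_def using finH finK by (subst sum.Sigma) auto
  also have "\<dots> = (\<Sum>y\<in>Y. case F y of (n, A, j) \<Rightarrow> R A * s j)"
    by (intro sum.cong) (auto simp: F_def s_def SH(2) [symmetric] power2_eq_square simp del: One_nat_def)
  also have "\<dots> = (\<Sum>(n, A, j)\<in>F ` Y. R A * s j)"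
    using inj_F by (subst sum.reindex) (auto simp: o_def)
  also have "\<dots> \<le> (\<Sum>(n, A, j)\<in>X. R A * s j)"
    using finX F_X XR_nonneg by (intro sum_mono2) (auto simp: X_def)
  also have "\<dots> = (\<Sum>(n, A, j)\<in>{1..N} \<times> I \<times> J. if n * u A = v j then R A * s j else 0)"
    using I finJ by (intro sum.mono_neutral_cong_left) (auto simp: X_def split: if_splits)
  also have "\<dots> = (\<Sum>n=1..N. \<Sum>A\<in>I. \<Sum>j\<in>J. if n * u A = v j then R A * s j else 0)"
    by (simp add: sum.cartesian_product)
  finally have "\<kappa> * sqrt N * (\<theta> * (\<Prod>p\<in>P. 1 + r p ^ 2 + r p / sqrt p)) / sqrt N \<le> \<dots> / sqrt N"
    by (rule divide_right_mono) simp
  hence "\<kappa> * (\<theta> * (\<Prod>p\<in>P. 1 + r p ^ 2 + r p / sqrt p)) \<le>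
     1 / sqrt N * (\<Sum>n=1..N. \<Sum>A\<in>I. \<Sum>j\<in>J. if n * u A = v j then R A * s j else 0)"
    using M by simp
  thus ?thesis using main by (simp add: W_def)
qed

section \<open>Choice of parameters\<close>

text \<open>With z = t p / (1 + a p + t p), the quotient (1 + a p) / (1 + a p + t p) equals 1 - z <=
  exp (- z), and z >= t p / (1 + \<epsilon>). It bounds from below the quotient of the Euler
  products of the diagonal and of the square sum.\<close>

lemma exp_sum_mult_prod_le:
  fixes a t :: "'a \<Rightarrow> real"
  assumes "\<And>p. p \<in> P \<Longrightarrow> a p \<ge> 0" "\<And>p. p \<in> P \<Longrightarrow> t p \<ge> 0" "\<And>p. p \<in> P \<Longrightarrow> a p + t p \<le> \<epsilon>"
  shows "exp ((\<Sum>p\<in>P. t p) / (1 + \<epsilon>)) * (\<Prod>p\<in>P. 1 + a p) \<le> (\<Prod>p\<in>P. 1 + a p + t p)"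
proof (cases "finite P")
  case True
  have "exp (t p / (1 + \<epsilon>)) * (1 + a p) \<le> 1 + a p + t p" if p: "p \<in> P" for p
  proof -
    have at: "a p \<ge> 0" "t p \<ge> 0" "a p + t p \<le> \<epsilon>" using assms p by auto
    define z where "z = t p / (1 + a p + t p)"
    have "1 - z \<le> exp (- z)" using exp_ge_add_one_self[of "- z"] by simp
    moreover have "1 - z = (1 + a p) / (1 + a p + t p)" using at by (simp add: z_def field_simps)
    ultimately have "(1 + a p) * exp z \<le> (1 + a p + t p) * (exp (- z) * exp z)"
      using at by (simp add: divide_le_eq mult_ac)
    hence *: "(1 + a p) * exp z \<le> 1 + a p + t p" by (simp flip: exp_add)
    have "t p / (1 + \<epsilon>) \<le> z" unfolding z_def using at by (intro divide_left_mono mult_pos_pos) auto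
    hence "exp (t p / (1 + \<epsilon>)) * (1 + a p) \<le> exp z * (1 + a p)" using at by (intro mult_right_mono) auto
    with * show ?thesis by (simp add: mult_ac)
  qed
  hence "(\<Prod>p\<in>P. exp (t p / (1 + \<epsilon>)) * (1 + a p)) \<le> (\<Prod>p\<in>P. 1 + a p + t p)"
    using assms(1) by (intro prod_mono) auto
  thus ?thesis using True by (simp add: prod.distrib exp_sum [symmetric] sum_divide_distrib)
qed auto

text \<open>The trivial bound ensures that the supremum over t is taken over a bounded set.\<close>

lemma norm_dirichlet_poly_le:
  assumes "\<And>n. n \<ge> 1 \<Longrightarrow> norm (f n) = 1"
  shows "norm (dirichlet_poly f N t) \<le> 1 / sqrt (real N) * real N"
proof -
  have "norm (\<Sum>n=1..N. f n * of_nat n powr (\<i> * of_real t)) \<le> (\<Sum>n=1..N. 1)"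
  proof (intro order.trans[OF norm_sum] sum_mono)
    fix n assume "n \<in> {1..N}"
    thus "norm (f n * of_nat n powr (\<i> * of_real t)) \<le> 1"
      using assms[of n] by (simp add: norm_mult powr_def Ln_of_nat)
  qed
  thus ?thesis unfolding dirichlet_poly_def norm_mult by (intro mult_mono) (auto simp: norm_divide)
qed

text \<open>Comparison with all integers up to Y. The logarithm this costs is later absorbed by the
  factor X powr h.\<close>

lemma sum_inverse_le:
  assumes "finite P" "\<And>p. p \<in> P \<Longrightarrow> 1 \<le> p \<and> real p \<le> Y" "Y \<ge> 1"
  shows "(\<Sum>p\<in>P. 1 / real p) \<le> 1 + ln Y"
proof -
  define m where "m = nat \<lfloor>Y\<rfloor>"
  have m: "m \<ge> 1" "real m \<le> Y" using assms(3) unfolding m_def by linarith+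
  have "P \<subseteq> {1..m}" using assms(2) by (auto simp: m_def le_nat_floor Suc_le_eq)
  hence "(\<Sum>p\<in>P. 1 / real p) \<le> (\<Sum>p=1..m. 1 / real p)" by (intro sum_mono2) auto
  also have "\<dots> = harm m" by (simp add: harm_def inverse_eq_divide)
  also have "\<dots> \<le> 1 + ln (real m)"
    using m by (intro harm_le_ln) simp
  also have "\<dots> \<le> 1 + ln Y" using m by simp
  finally show ?thesis .
qed

text \<open>All requirements that hold for large X appear as hypotheses: \<open>small\<close>
  controls the Markov means and the size of \<open>r\<close>, \<open>sq\<close> places the primes k
  above X powr A, and \<open>qu\<close> makes N powr (1/4) exceed the logarithms in the off-diagonal
  error.\<close>

lemma dirichlet_poly_large_value:
  fixes f :: "nat \<Rightarrow> complex" and N :: nat and T X A D \<epsilon> \<delta> h :: real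
  assumes f: "completely_multiplicative f" "\<And>n. n \<ge> 1 \<Longrightarrow> norm (f n) = 1"
    and T: "T = exp X" and \<epsilon>: "0 < \<epsilon>" "\<epsilon> < 1" and \<delta>: "0 < \<delta>" "\<delta> < 1" and D: "D > 1" and A: "A > 1"
    and X: "X > 1" "ln X > 1" and N: "N > 1" "ln N \<le> \<delta> / 2 * X" "X powr (1/2 + h) \<le> ln N"
    and s: "(\<Sum>p::nat | prime p \<and> X < real p \<and> real p \<le> X powr A. 1 / (real p * ln (real p))) \<ge> (1 - \<epsilon>) / ln X"
    and small: "sqrt (X * ln X) * (6 / X powr (1/2 + h)) * (1 + A * ln X) \<le> \<epsilon> / 2" "2 / ln X \<le> \<epsilon>"
    and sq: "exp (X powr (1/2 + h) / 2) \<ge> D * X powr A"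
    and qu: "exp (X powr (1/2 + h) / 4) \<ge> 8 * (1 + X)"
    and Dp: "\<forall>x\<ge>D. (\<Sum>p::nat | prime p \<and> x / D < real p \<and> real p \<le> x. 1 / sqrt (real p)) \<ge> sqrt (x / D) / ln x"
  shows "\<epsilon> / (sqrt D * X) * exp ((1 - \<epsilon>) / (1 + \<epsilon>) * sqrt ((1 - 7 * \<delta> / 8) * (X / ln X))) \<le>
          (3 * (SUP t\<in>{t. \<bar>t\<bar> \<le> T}. norm (dirichlet_poly f N t)) + 1) * (1 + X)"
proof -
  define P where "P = {p::nat. prime p \<and> X < real p \<and> real p \<le> X powr A}"
  define K where "K = {k::nat. prime k \<and> X powr A < real k \<and> k \<le> N}"
  \<comment> \<open>M is T / N powr (7/4). Then q is about T / N powr (3/4), and q sqrt N is about T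
    / N powr (1/4), which leaves a factor N powr (1/4) for logarithms. As ln N <= (\<delta> / 2) X,
    the loss 7/4 ln N is at most (7 \<delta> / 8) X, which stays below \<delta> X.\<close>
  define M where "M = exp (X - 7 / 4 * ln N)"
  define S where "S = (\<Sum>p\<in>P. 1 / (real p * ln (real p)))"
  \<comment> \<open>This \<open>L\<close> makes the mean of \<open>ln m\<close> at most \<open>(1 - \<epsilon>) ln M\<close>, so only a lower bound for \<open>S\<close> is needed.\<close>
  define L where "L = sqrt ((1 - \<epsilon>) * ln M / S)"
  define r where "r = (\<lambda>p::nat. L / (sqrt (real p) * ln (real p)))"
  define q where "q = nat \<lceil>real N * M\<rceil>"
  define \<kappa> where "\<kappa> = 1 / (sqrt D * ln N)"
  define V where "V = (SUP t\<in>{t. \<bar>t\<bar> \<le> T}. norm (dirichlet_poly f N t))"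
  define g where "g = X powr (1/2 + h)"
  have finP: "finite P" using finite_nat_real_le[of "\<lambda>p. prime p \<and> X < real p" "X powr A"] by (simp add: P_def conj_assoc)
  have lnN: "ln N > 0" using N by simp
  have g0: "g > 0" using X by (simp add: g_def)
  have expN: "exp (ln N * c) = real N powr c" for c using N by (simp add: powr_def mult.commute)
  have lnN_X: "2 * ln N \<le> X"
  proof -
    have "\<delta> / 2 * X \<le> 1 / 2 * X" using \<delta> X by (intro mult_right_mono) auto
    thus ?thesis using N by linarith
  qed
  have lnM: "ln M = X - 7 / 4 * ln N" by (simp add: M_def)
  have lnM1: "ln M \<ge> (1 - 7 * \<delta> / 8) * X" using N by (simp add: lnM algebra_simps)
  have lnM2: "ln M \<ge> X / 8" using lnN_X by (simp add: lnM)
  have lnM3: "ln M \<le> X" using lnN by (simp add: lnM)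
  have lnM_pos: "ln M > 0" using lnM2 X by linarith
  have M1: "M > 1" using lnM_pos by (simp add: M_def)
  have S: "S \<ge> (1 - \<epsilon>) / ln X" using s by (simp add: S_def P_def)
  have S_pos: "S > 0" using S \<epsilon> X by (smt (verit) divide_pos_pos)
  have L_nonneg: "L \<ge> 0" using \<epsilon> lnM_pos S_pos by (simp add: L_def)
  have L2: "L ^ 2 = (1 - \<epsilon>) * ln M / S" using \<epsilon> lnM_pos S_pos by (simp add: L_def)
  have L_le: "L ^ 2 \<le> X * ln X"
  proof -
    have "L ^ 2 \<le> (1 - \<epsilon>) * ln M / ((1 - \<epsilon>) / ln X)"
      unfolding L2 using \<epsilon> lnM_pos S_pos S X by (intro divide_left_mono mult_pos_pos) auto
    also have "\<dots> = ln M * ln X" using \<epsilon> by simp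
    also have "\<dots> \<le> X * ln X" using lnM3 X by (intro mult_right_mono) auto
    finally show ?thesis .
  qed
  hence L_le': "L \<le> sqrt (X * ln X)" by (rule real_le_rsqrt)
  have Pp: "real p > X" "ln (real p) > ln X" "ln (real p) > 1" "real p > 1" if "p \<in> P" for p
  proof -
    show *: "real p > X" using that by (simp add: P_def)
    thus "ln (real p) > ln X" using X by simp
    thus "ln (real p) > 1" "real p > 1" using X * by linarith+
  qed
  have r_nonneg: "r p \<ge> 0" if "p \<in> P" for p using Pp[OF that] L_nonneg by (simp add: r_def)
  have r2: "r p ^ 2 = L ^ 2 * (1 / (real p * ln (real p))) / ln (real p)" if "p \<in> P" for p
    using Pp[OF that] by (simp add: r_def power_divide power_mult_distrib power2_eq_square)
  have rs: "r p / sqrt (real p) = L * (1 / (real p * ln (real p)))" if "p \<in> P" for p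
    using Pp[OF that] by (simp add: r_def)
  \<comment> \<open>The lower cutoff p > X matters here: with L ^ 2 <= X ln X it makes both r p ^ 2
    and r p / sqrt p at most 1 / ln X.\<close>
  have r_small: "r p ^ 2 + r p / sqrt (real p) \<le> \<epsilon>" if p: "p \<in> P" for p
  proof -
    have "r p ^ 2 = L ^ 2 / (real p * ln (real p) ^ 2)" using r2[OF p] by (simp add: power2_eq_square)
    also have "\<dots> \<le> (X * ln X) / (X * ln X ^ 2)"
      using L_le X Pp[OF p] by (intro frac_le mult_mono power_mono mult_pos_pos) auto
    also have "\<dots> = 1 / ln X" using X by (simp add: power2_eq_square)
    finally have 1: "r p ^ 2 \<le> 1 / ln X" .
    have X_lnX: "1 \<le> X * ln X" using X mult_mono[of 1 X 1 "ln X"] by simp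
    have "r p / sqrt (real p) = L / (real p * ln (real p))" using rs[OF p] by simp
    also have "\<dots> \<le> sqrt (X * ln X) / (X * ln X)"
      using L_le' L_nonneg X Pp[OF p] by (intro frac_le mult_mono mult_pos_pos) auto
    also have "\<dots> = 1 / sqrt (X * ln X)" using X_lnX by (simp add: sqrt_divide_self_eq inverse_eq_divide)
    also have "\<dots> \<le> 1 / ln X"
    proof -
      have "ln X \<le> X" using ln_le_minus_one[of X] X by linarith
      hence "ln X * ln X \<le> X * ln X" using X by (intro mult_right_mono) auto
      hence "ln X \<le> sqrt (X * ln X)" by (intro real_le_rsqrt) (simp add: power2_eq_square)
      thus ?thesis using X by (intro divide_left_mono) auto
    qed
    finally show ?thesis using 1 small(2) by simp
  qed
  \<comment> \<open>The first terms add up to exactly 1 - \<epsilon> by the choice of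
    \<open>L\<close>. The others are at most L / ln N up to a factor logarithmic in X, that is X
    powr (- h) up to logarithms, and fit into \<epsilon> / 2.\<close>
  have theta: "(\<Sum>p\<in>P. r p ^ 2 * (ln p / ln M) + r p / sqrt p * (ln p / ln M + 2 * ln p / ln N)) \<le> 1 - \<epsilon> / 2"
  proof -
    have "(\<Sum>p\<in>P. r p ^ 2 * (ln p / ln M) + r p / sqrt p * (ln p / ln M + 2 * ln p / ln N)) =
          (\<Sum>p\<in>P. L ^ 2 / ln M * (1 / (real p * ln (real p))) + L * (1 / ln M + 2 / ln N) * (1 / real p))"
    proof (rule sum.cong[OF refl])
      fix p assume p: "p \<in> P"
      show "r p ^ 2 * (ln p / ln M) + r p / sqrt p * (ln p / ln M + 2 * ln p / ln N) =
            L ^ 2 / ln M * (1 / (real p * ln (real p))) + L * (1 / ln M + 2 / ln N) * (1 / real p)"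
        unfolding r2[OF p] rs[OF p] using Pp[OF p] lnM_pos lnN by (simp add: field_simps)
    qed
    also have "\<dots> = L ^ 2 / ln M * S + L * (1 / ln M + 2 / ln N) * (\<Sum>p\<in>P. 1 / real p)"
      by (simp only: S_def sum.distrib sum_distrib_left)
    also have "L ^ 2 / ln M * S = 1 - \<epsilon>" using lnM_pos S_pos by (simp add: L2)
    also have "L * (1 / ln M + 2 / ln N) * (\<Sum>p\<in>P. 1 / real p) \<le> sqrt (X * ln X) * (6 / g) * (1 + A * ln X)"
    proof (intro mult_mono)
      have "1 / ln M \<le> 1 / (X / 8)" using lnM2 X lnM_pos by (intro divide_left_mono) auto
      also have "\<dots> \<le> 4 / ln N" using lnN_X lnN X by (simp add: field_simps)
      finally have "1 / ln M + 2 / ln N \<le> 6 / ln N" by simp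
      also have "\<dots> \<le> 6 / g" using N(3) g0 lnN by (intro divide_left_mono) (auto simp: g_def)
      finally show "1 / ln M + 2 / ln N \<le> 6 / g" .
      have "(\<Sum>p\<in>P. 1 / real p) \<le> 1 + ln (X powr A)"
      proof (rule sum_inverse_le[OF finP])
        show "1 \<le> p \<and> real p \<le> X powr A" if "p \<in> P" for p using that Pp[OF that] by (auto simp: P_def)
      qed (use X A in \<open>auto intro!: ge_one_powr_ge_zero\<close>)
      thus "(\<Sum>p\<in>P. 1 / real p) \<le> 1 + A * ln X" using X by (simp add: ln_powr)
    qed (use L_le' L_nonneg X lnM_pos lnN g0 in \<open>auto intro!: sum_nonneg add_nonneg_nonneg mult_nonneg_nonneg\<close>)
    also have "\<dots> \<le> \<epsilon> / 2" using small(1) by (simp only: g_def)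
    finally show ?thesis by simp
  qed
  \<comment> \<open>For x >= sqrt N this places the whole block (x / D, x] above X powr A, so its
    primes belong to \<open>K\<close> and avoid \<open>P\<close>.\<close>
  have sqrtN: "sqrt (real N) \<ge> D * X powr A"
  proof -
    have "D * X powr A \<le> exp (g / 2)" using sq by (simp only: g_def)
    also have "\<dots> \<le> exp (ln N * (1 / 2))" using N(3) by (simp add: g_def)
    also have "\<dots> = sqrt (real N)" unfolding expN by (simp add: powr_half_sqrt)
    finally show ?thesis .
  qed
  have K\<kappa>: "(\<Sum>k | k \<in> K \<and> real k \<le> x. 1 / sqrt (real k)) \<ge> \<kappa> * sqrt x" if x: "sqrt (real N) \<le> x" "x \<le> real N" for x
  proof -
    have XA: "X powr A \<ge> 1" using X A by (intro ge_one_powr_ge_zero) auto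
    have "D * 1 \<le> D * X powr A" using XA D by (intro mult_left_mono) auto
    hence xD: "x \<ge> D" using sqrtN x by linarith
    have x1: "x > 1" using xD D by linarith
    have "\<kappa> * sqrt x \<le> sqrt (x / D) / ln x"
    proof -
      have "\<kappa> * sqrt x = sqrt (x / D) / ln N" by (simp add: \<kappa>_def real_sqrt_divide)
      also have "\<dots> \<le> sqrt (x / D) / ln x"
        using x x1 D lnN by (intro divide_left_mono mult_pos_pos) auto
      finally show ?thesis .
    qed
    also have "\<dots> \<le> (\<Sum>p::nat | prime p \<and> x / D < real p \<and> real p \<le> x. 1 / sqrt (real p))"
      using Dp xD by blast
    also have "\<dots> \<le> (\<Sum>k | k \<in> K \<and> real k \<le> x. 1 / sqrt (real k))"
    proof (rule sum_mono2)
      show "finite {k \<in> K. real k \<le> x}" by (rule finite_nat_real_le)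
      have "X powr A \<le> x / D" using sqrtN x D by (simp add: pos_le_divide_eq mult.commute)
      thus "{p::nat. prime p \<and> x / D < real p \<and> real p \<le> x} \<subseteq> {k \<in> K. real k \<le> x}"
        using x by (auto simp: K_def)
    qed auto
    finally show ?thesis .
  qed
  have N4: "real N powr (1/4) \<ge> 8 * (1 + X)"
  proof -
    have "8 * (1 + X) \<le> exp (g / 4)" using qu by (simp only: g_def)
    also have "\<dots> \<le> exp (ln N * (1 / 4))" using N(3) by (simp add: g_def)
    finally show ?thesis unfolding expN .
  qed
  have NM: "real N * M = T * real N powr (-3/4)"
  proof -
    have "real N * M = exp (ln N) * exp (X - 7 / 4 * ln N)" using N by (simp add: M_def)
    also have "\<dots> = exp X * exp (ln N * (-3/4))" by (simp flip: exp_add)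
    finally show ?thesis unfolding expN T .
  qed
  have q_ge: "real N * M \<le> real q" unfolding q_def by linarith
  have NM1: "real N * M > 1" using N M1 by (intro less_1_mult) auto
  have q_le: "real q \<le> 2 * T * real N powr (-3/4)" using NM NM1 unfolding q_def by linarith
  have qT: "4 * real q * (1 + ln (real q)) * sqrt (real N) \<le> T"
  proof -
    have N4': "real N powr (1/4) \<ge> 2" using N4 X by simp
    have "real N powr (-3/4) \<le> real N powr (-1/4)" using N by (intro powr_mono) auto
    also have "\<dots> = 1 / real N powr (1/4)" by (simp add: powr_minus_divide)
    also have "\<dots> \<le> 1 / 2" using N4' N by (intro divide_left_mono) auto
    finally have "2 * T * real N powr (-3/4) \<le> 2 * T * (1 / 2)" by (intro mult_left_mono) (auto simp: T)
    hence "real q \<le> exp X" using q_le T by linarith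
    moreover have q0: "real q > 1" using q_ge NM1 by linarith
    ultimately have lnq: "ln (real q) \<le> X" using ln_le_cancel_iff[of "real q" "exp X"] by simp
    have "4 * real q * (1 + ln (real q)) * sqrt (real N) \<le> 4 * (2 * T * real N powr (-3/4)) * (1 + X) * sqrt (real N)"
      using q_le lnq q0 X by (intro mult_right_mono mult_mono) (auto simp: T)
    also have "\<dots> = T * (8 * (1 + X)) * (real N powr (-3/4) * real N powr (1/2))"
      by (simp add: powr_half_sqrt)
    also have "real N powr (-3/4) * real N powr (1/2) = real N powr (-1/4)"
      using N by (simp flip: powr_add)
    also have "T * (8 * (1 + X)) * real N powr (-1/4) \<le> T * real N powr (1/4) * real N powr (-1/4)"
      using N4 by (intro mult_right_mono mult_left_mono) (auto simp: T)
    also have "\<dots> = T" using N by (simp add: mult.assoc flip: powr_add)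
    finally show ?thesis .
  qed
  have bdd: "bdd_above ((\<lambda>t. norm (dirichlet_poly f N t)) ` {t. \<bar>t\<bar> \<le> T})"
    using norm_dirichlet_poly_le[of f N] f(2) by (intro bdd_aboveI2) blast
  have V: "norm (dirichlet_poly f N t) \<le> V" if "\<bar>t\<bar> \<le> T" for t
    unfolding V_def using that by (intro cSUP_upper bdd) auto
  have V0: "V \<ge> 0" using order.trans[OF norm_ge_zero V[of 0]] by (simp add: T)
  let ?Z = "\<Prod>p\<in>P. 1 + r p ^ 2"
  let ?E = "(\<Sum>p\<in>P. r p / sqrt (real p)) / (1 + \<epsilon>)"
  have main: "2 * \<kappa> * (\<epsilon> / 2) * (\<Prod>p\<in>P. 1 + r p ^ 2 + r p / sqrt p) \<le> (3 * V + 1) * ((1 + ln N) * ?Z)"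
  proof (rule resonator_lower_bound[where K = K and M = M and q = q and T = T and f = f])
    show "prime p" if "p \<in> P" for p using that by (simp add: P_def)
    show "prime k \<and> k \<notin> P \<and> k \<le> N" if "k \<in> K" for k using that by (auto simp: K_def P_def)
    show "\<kappa> \<ge> 0" using lnN D by (simp add: \<kappa>_def)
  qed (use f finP r_nonneg K\<kappa> M1 N q_ge theta qT V in auto)
  have Z: "?Z > 0" by (intro prod_pos) (auto intro: add_pos_nonneg)
  have "\<kappa> * \<epsilon> * (exp ?E * ?Z) \<le> \<kappa> * \<epsilon> * (\<Prod>p\<in>P. 1 + r p ^ 2 + r p / sqrt p)"
    using \<epsilon> lnN D r_nonneg r_small by (intro mult_left_mono exp_sum_mult_prod_le) (auto simp: \<kappa>_def)
  also have "\<dots> \<le> (3 * V + 1) * (1 + ln N) * ?Z" using main by (simp add: mult_ac)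
  finally have "(\<kappa> * \<epsilon> * exp ?E) * ?Z \<le> ((3 * V + 1) * (1 + ln N)) * ?Z" by (simp only: mult.assoc)
  hence *: "\<kappa> * \<epsilon> * exp ?E \<le> (3 * V + 1) * (1 + ln N)" using Z by (simp only: mult_le_cancel_right_pos)
  \<comment> \<open>The exponent is L S, where \<open>L\<close> contains S powr (-1/2). So L S is
    proportional to sqrt S, and the lower bound for S suffices.\<close>
  have E: "(1 - \<epsilon>) / (1 + \<epsilon>) * sqrt ((1 - 7 * \<delta> / 8) * (X / ln X)) \<le> ?E"
  proof -
    have "(\<Sum>p\<in>P. r p / sqrt (real p)) = L * S" unfolding S_def sum_distrib_left by (intro sum.cong refl rs)
    also have "L * S = sqrt ((1 - \<epsilon>) * ln M / S * S ^ 2)"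
      using S_pos by (simp only: L_def real_sqrt_mult real_sqrt_abs abs_of_pos)
    also have "(1 - \<epsilon>) * ln M / S * S ^ 2 = (1 - \<epsilon>) * ln M * S" using S_pos by (simp add: power2_eq_square)
    finally have eq: "(\<Sum>p\<in>P. r p / sqrt (real p)) = sqrt ((1 - \<epsilon>) * ln M * S)" .
    have "(1 - \<epsilon>) * sqrt ((1 - 7 * \<delta> / 8) * (X / ln X)) = sqrt ((1 - \<epsilon>) ^ 2 * ((1 - 7 * \<delta> / 8) * (X / ln X)))"
      using \<epsilon> by (simp only: real_sqrt_mult real_sqrt_abs)
    also have "(1 - \<epsilon>) ^ 2 * ((1 - 7 * \<delta> / 8) * (X / ln X)) = (1 - \<epsilon>) * ((1 - 7 * \<delta> / 8) * X) * ((1 - \<epsilon>) / ln X)"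
      by (simp add: power2_eq_square)
    also have "sqrt \<dots> \<le> sqrt ((1 - \<epsilon>) * ln M * S)"
      using \<epsilon> \<delta> X lnM1 S lnM_pos by (intro real_sqrt_le_mono mult_mono) auto
    finally have "(1 - \<epsilon>) * sqrt ((1 - 7 * \<delta> / 8) * (X / ln X)) \<le> (\<Sum>p\<in>P. r p / sqrt (real p))" unfolding eq .
    thus ?thesis using \<epsilon> by (simp add: divide_right_mono)
  qed
  have "\<epsilon> / (sqrt D * X) * exp ((1 - \<epsilon>) / (1 + \<epsilon>) * sqrt ((1 - 7 * \<delta> / 8) * (X / ln X))) \<le> \<kappa> * \<epsilon> * exp ?E"
  proof (rule mult_mono)
    have "\<epsilon> / (sqrt D * X) \<le> \<epsilon> / (sqrt D * ln N)"
      using \<epsilon> D lnN lnN_X by (intro divide_left_mono mult_left_mono mult_pos_pos) auto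
    thus "\<epsilon> / (sqrt D * X) \<le> \<kappa> * \<epsilon>" by (simp add: \<kappa>_def)
  qed (use E \<epsilon> D lnN in \<open>auto simp: \<kappa>_def\<close>)
  also have "\<dots> \<le> (3 * V + 1) * (1 + ln N)" by (rule *)
  also have "\<dots> \<le> (3 * V + 1) * (1 + X)" using V0 lnN lnN_X by (intro mult_left_mono) auto
  finally show ?thesis by (simp only: V_def)
qed

text \<open>sqrt (X / ln X) outgrows ln X, so an arbitrarily small surplus in the exponent absorbs
  every fixed power of X.\<close>

lemma eventually_exp_gap:
  fixes c\<^sub>0 c\<^sub>1 k :: real
  assumes "c\<^sub>0 < c\<^sub>1" "0 \<le> c\<^sub>0" "0 < k"
  shows "\<forall>\<^sub>F X in at_top. (3 * exp (c\<^sub>0 * sqrt (X / ln X)) + 1) * (1 + X) \<le> k / X * exp (c\<^sub>1 * sqrt (X / ln X))"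
proof -
  have "\<forall>\<^sub>F X in at_top. 4 / k * (X * (1 + X)) \<le> exp ((c\<^sub>1 - c\<^sub>0) * sqrt (X / ln X))"
    using assms by real_asymp
  moreover have "\<forall>\<^sub>F X::real in at_top. X > 1" by (rule eventually_gt_at_top)
  ultimately show ?thesis
  proof eventually_elim
    case (elim X)
    define y where "y = sqrt (X / ln X)"
    have "y \<ge> 0" using elim by (simp add: y_def)
    hence "exp (c\<^sub>0 * y) \<ge> 1" using assms by simp
    hence "(3 * exp (c\<^sub>0 * y) + 1) * (1 + X) \<le> (4 * exp (c\<^sub>0 * y)) * (1 + X)"
      using elim by (intro mult_right_mono) auto
    also have "\<dots> = k / X * exp (c\<^sub>0 * y) * (4 / k * (X * (1 + X)))" using elim assms by simp
    also have "\<dots> \<le> k / X * exp (c\<^sub>0 * y) * exp ((c\<^sub>1 - c\<^sub>0) * y)"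
      using elim assms by (intro mult_left_mono) (auto simp: y_def)
    also have "\<dots> = k / X * exp (c\<^sub>1 * y)"
      by (simp add: mult.assoc algebra_simps flip: exp_add)
    finally show ?case by (simp only: y_def)
  qed
qed

text \<open>The squared quotient is at least 1 - 4 \<epsilon> = 1 - \<delta> / 16. Multiplied by 1 -
  7 \<delta> / 8 it still exceeds 1 - 15 \<delta> / 16, so the value \<delta> / 64 uses up only half
  of the reserve \<delta> / 8.\<close>

lemma exponent_gap:
  fixes \<delta> \<epsilon> :: real
  assumes "0 < \<delta>" "\<delta> < 1" "\<epsilon> = \<delta> / 64"
  shows "sqrt (1 - \<delta>) < (1 - \<epsilon>) / (1 + \<epsilon>) * sqrt (1 - 7 * \<delta> / 8)"
proof -
  have \<epsilon>: "0 < \<epsilon>" "\<epsilon> < 1" using assms by auto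
  have "(1 - \<epsilon>) ^ 2 - (1 - 4 * \<epsilon>) * (1 + \<epsilon>) ^ 2 = 8 * \<epsilon> ^ 2 + 4 * \<epsilon> ^ 3"
    by (simp add: power2_eq_square power3_eq_cube algebra_simps)
  also have "\<dots> \<ge> 0" using \<epsilon> by simp
  finally have "(1 - 4 * \<epsilon>) * (1 + \<epsilon>) ^ 2 \<le> (1 - \<epsilon>) ^ 2" by simp
  hence sq: "1 - 4 * \<epsilon> \<le> ((1 - \<epsilon>) / (1 + \<epsilon>)) ^ 2"
    using \<epsilon> by (simp add: power_divide pos_le_divide_eq)
  have "(1 - 4 * \<epsilon>) * (1 - 7 * \<delta> / 8) = 1 - \<delta> + \<delta> / 16 + 7 * \<delta> ^ 2 / 128"
    by (simp add: assms(3) power2_eq_square field_simps)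
  moreover have "7 * \<delta> ^ 2 / 128 \<ge> 0" by simp
  ultimately have "1 - \<delta> < (1 - 4 * \<epsilon>) * (1 - 7 * \<delta> / 8)" using assms by linarith
  also have "\<dots> \<le> ((1 - \<epsilon>) / (1 + \<epsilon>)) ^ 2 * (1 - 7 * \<delta> / 8)"
    using sq assms by (intro mult_right_mono) auto
  finally have "sqrt (1 - \<delta>) < sqrt (((1 - \<epsilon>) / (1 + \<epsilon>)) ^ 2 * (1 - 7 * \<delta> / 8))"
    by (rule real_sqrt_less_mono)
  also have "\<dots> = (1 - \<epsilon>) / (1 + \<epsilon>) * sqrt (1 - 7 * \<delta> / 8)"
    using \<epsilon> by (simp only: real_sqrt_mult real_sqrt_abs) simp
  finally show ?thesis .
qed

theorem theorem1p1:
  fixes \<delta> \<gamma> :: real and C T :: "nat \<Rightarrow> real"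
  assumes "0 < \<delta>" "\<delta> < 1" "0 < \<gamma>" "\<gamma> < 1"
    and "\<forall>\<^sub>F N in sequentially. 2 / \<delta> \<le> C N \<and> C N \<le> ln (real N) powr \<gamma>"
    and "\<And>N. N \<ge> 1 \<Longrightarrow> T N = real N powr C N"
  shows "\<exists>N\<^sub>0::nat. \<forall>N\<ge>N\<^sub>0. \<forall>f. completely_multiplicative f \<and> (\<forall>n\<ge>1. norm (f n) = 1) \<longrightarrow>
           (SUP t\<in>{t::real. \<bar>t\<bar> \<le> T N}. norm (dirichlet_poly f N t))
             \<ge> exp (sqrt ((1 - \<delta>) * (ln (T N) / ln (ln (T N)))))"
proof -
  define \<epsilon> where "\<epsilon> = \<delta> / 64"
  \<comment> \<open>From X = C N * ln N <= (ln N) powr (1 + \<gamma>) follows ln N >= X powr (1 / (1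
    + \<gamma>)). The exponent is 1/2 + h, and \<gamma> < 1 means h > 0.\<close>
  define h where "h = 1 / (1 + \<gamma>) - 1 / 2"
  define c\<^sub>0 where "c\<^sub>0 = sqrt (1 - \<delta>)"
  define c\<^sub>1 where "c\<^sub>1 = (1 - \<epsilon>) / (1 + \<epsilon>) * sqrt (1 - 7 * \<delta> / 8)"
  have \<epsilon>: "0 < \<epsilon>" "\<epsilon> < 1" using assms(1,2) by (auto simp: \<epsilon>_def)
  have h: "h > 0" using assms(3,4) by (simp add: h_def field_simps)
  have c: "c\<^sub>0 < c\<^sub>1" "0 \<le> c\<^sub>0"
    using exponent_gap[OF assms(1,2) \<epsilon>_def] assms(2) by (simp_all add: c\<^sub>0_def c\<^sub>1_def)
  obtain A where A: "A > 1" "\<forall>\<^sub>F y in at_top.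
      (\<Sum>p::nat | prime p \<and> y < real p \<and> real p \<le> y powr A. 1 / (real p * ln (real p))) \<ge> (1 - \<epsilon>) / ln y"
    using sum_inverse_prime_ln[OF \<epsilon>] by blast
  obtain D where D: "D > 1" "\<forall>x\<ge>D. (\<Sum>p::nat | prime p \<and> x / D < real p \<and> real p \<le> x. 1 / sqrt (real p)) \<ge> sqrt (x / D) / ln x"
    using sum_inverse_sqrt_primes by blast
  \<comment> \<open>The conditions involve N only through X and do not mention \<open>f\<close>, so
    the resulting threshold is uniform in \<open>f\<close>.\<close>
  define good where "good = (\<lambda>X. X > 1 \<and> ln X > 1 \<and>
     (\<Sum>p::nat | prime p \<and> X < real p \<and> real p \<le> X powr A. 1 / (real p * ln (real p))) \<ge> (1 - \<epsilon>) / ln X \<and>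
     sqrt (X * ln X) * (6 / X powr (1/2 + h)) * (1 + A * ln X) \<le> \<epsilon> / 2 \<and> 2 / ln X \<le> \<epsilon> \<and>
     exp (X powr (1/2 + h) / 2) \<ge> D * X powr A \<and> exp (X powr (1/2 + h) / 4) \<ge> 8 * (1 + X) \<and>
     (3 * exp (c\<^sub>0 * sqrt (X / ln X)) + 1) * (1 + X) \<le> \<epsilon> / sqrt D / X * exp (c\<^sub>1 * sqrt (X / ln X)))"
  have good: "\<forall>\<^sub>F X in at_top. good X"
    unfolding good_def
  proof (intro eventually_conj A(2) eventually_exp_gap c)
    show "\<forall>\<^sub>F X in at_top. sqrt (X * ln X) * (6 / X powr (1/2 + h)) * (1 + A * ln X) \<le> \<epsilon> / 2"
      "\<forall>\<^sub>F X in at_top. exp (X powr (1/2 + h) / 2) \<ge> D * X powr A"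
      "\<forall>\<^sub>F X in at_top. exp (X powr (1/2 + h) / 4) \<ge> 8 * (1 + X)"
      "\<forall>\<^sub>F X in at_top. 2 / ln X \<le> \<epsilon>"
      using h A(1) D(1) \<epsilon> by real_asymp+
    show "\<forall>\<^sub>F X::real in at_top. X > 1" "\<forall>\<^sub>F X::real in at_top. ln X > 1" by real_asymp+
    show "0 < \<epsilon> / sqrt D" using \<epsilon> D by simp
  qed
  have lnN: "filterlim (\<lambda>N::nat. ln (real N)) at_top sequentially" by real_asymp
  have N1: "\<forall>\<^sub>F N in sequentially. N > (1::nat)" by (rule eventually_gt_at_top)
  \<comment> \<open>Nothing is known about the regularity of \<open>C\<close>; the lower bound 2 /
    \<delta> alone drives X to infinity.\<close>
  have "filterlim (\<lambda>N. C N * ln (real N)) at_top sequentially"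
  proof (rule filterlim_at_top_mono)
    show "filterlim (\<lambda>N::nat. 2 / \<delta> * ln (real N)) at_top sequentially"
      using assms(1) by real_asymp
    show "\<forall>\<^sub>F N in sequentially. 2 / \<delta> * ln (real N) \<le> C N * ln (real N)"
      using assms(5) N1 by eventually_elim (rule mult_right_mono, auto)
  qed
  hence "\<forall>\<^sub>F N in sequentially. good (C N * ln (real N))"
    using good by (rule eventually_compose_filterlim[rotated])
  hence "\<forall>\<^sub>F N in sequentially. good (C N * ln (real N)) \<and> N > 1 \<and> 2 / \<delta> \<le> C N \<and> C N \<le> ln (real N) powr \<gamma>"
    using N1 assms(5) by eventually_elim blast
  then obtain N\<^sub>0 where N\<^sub>0: "\<And>N. N \<ge> N\<^sub>0 \<Longrightarrow>
      good (C N * ln (real N)) \<and> N > 1 \<and> 2 / \<delta> \<le> C N \<and> C N \<le> ln (real N) powr \<gamma>"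
    unfolding eventually_sequentially by blast
  show ?thesis
  proof (intro exI[of _ N\<^sub>0] allI impI)
    fix N f assume N: "N \<ge> N\<^sub>0" and f: "completely_multiplicative f \<and> (\<forall>n\<ge>1. norm (f n) = 1)"
    define X where "X = C N * ln (real N)"
    have C: "N > 1" "2 / \<delta> \<le> C N" "C N \<le> ln (real N) powr \<gamma>" and gX: "good X"
      using N\<^sub>0[OF N] by (auto simp: X_def)
    have lnN0: "ln (real N) > 0" using C by simp
    have T: "T N = exp X" using assms(6)[of N] C by (simp add: X_def powr_def)
    have X1: "X > 1" "ln X > 1" using gX by (auto simp: good_def)
    define V where "V = (SUP t\<in>{t. \<bar>t\<bar> \<le> T N}. norm (dirichlet_poly f N t))"
    have "\<epsilon> / (sqrt D * X) * exp ((1 - \<epsilon>) / (1 + \<epsilon>) * sqrt ((1 - 7 * \<delta> / 8) * (X / ln X))) \<le> (3 * V + 1) * (1 + X)"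
      unfolding V_def
    proof (rule dirichlet_poly_large_value[where A = A and h = h])
      have "\<delta> / 2 * (2 / \<delta> * ln (real N)) \<le> \<delta> / 2 * X"
        unfolding X_def using C lnN0 assms(1) by (intro mult_left_mono mult_right_mono) auto
      thus "ln (real N) \<le> \<delta> / 2 * X" using assms(1) by simp
      have "X \<le> ln (real N) powr \<gamma> * ln (real N)"
        unfolding X_def using C lnN0 by (intro mult_right_mono) auto
      also have "\<dots> = ln (real N) powr (1 + \<gamma>)" using lnN0 by (simp add: powr_add)
      finally have "X powr (1 / (1 + \<gamma>)) \<le> (ln (real N) powr (1 + \<gamma>)) powr (1 / (1 + \<gamma>))"
        using X1 assms(3) by (intro powr_mono2) auto
      also have "\<dots> = ln (real N)" using lnN0 assms(3) by (simp add: powr_powr)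
      finally show "X powr (1/2 + h) \<le> ln (real N)" by (simp add: h_def)
    qed (use f T \<epsilon> assms(1,2) A(1) D C gX in \<open>auto simp: good_def\<close>)
    also have "sqrt ((1 - 7 * \<delta> / 8) * (X / ln X)) = sqrt (1 - 7 * \<delta> / 8) * sqrt (X / ln X)"
      by (rule real_sqrt_mult)
    finally have "\<epsilon> / sqrt D / X * exp (c\<^sub>1 * sqrt (X / ln X)) \<le> (3 * V + 1) * (1 + X)"
      by (simp add: c\<^sub>1_def mult.assoc)
    moreover have "(3 * exp (c\<^sub>0 * sqrt (X / ln X)) + 1) * (1 + X) \<le> \<epsilon> / sqrt D / X * exp (c\<^sub>1 * sqrt (X / ln X))"
      using gX by (simp only: good_def)
    ultimately have "(3 * exp (c\<^sub>0 * sqrt (X / ln X)) + 1) * (1 + X) \<le> (3 * V + 1) * (1 + X)" by linarith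
    hence "3 * exp (c\<^sub>0 * sqrt (X / ln X)) + 1 \<le> 3 * V + 1" using X1 by (simp only: mult_le_cancel_right_pos)
    moreover have "sqrt ((1 - \<delta>) * (ln (T N) / ln (ln (T N)))) = c\<^sub>0 * sqrt (X / ln X)"
      by (simp add: T c\<^sub>0_def flip: real_sqrt_mult)
    ultimately show "(SUP t\<in>{t. \<bar>t\<bar> \<le> T N}. norm (dirichlet_poly f N t)) \<ge> exp (sqrt ((1 - \<delta>) * (ln (T N) / ln (ln (T N)))))"
      unfolding V_def by simp
  qed
qed

end
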